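(* Let $T\in(0,\infty)$ be fixed, let $\alpha:[0,T)\to\mathbb{R}$ be a continuous function, and let $(B_t)_{t\geq 0}$ be a one-dimensional standard Wiener process on a filtered probability space $(\Omega,\mathcal{F},(\mathcal{F}_t)_{t\in[0,T)},\mathsf{P})$ satisfying the usual conditions, the filtration being constructed by the help of $B$. If the limit $\alpha(T):=\lim_{t\uparrow T}\alpha(t)$ exists and $\alpha(T)>0$, then the process $(X_t)_{t\in[0,T]}$ defined by $$X_t:=\begin{cases}\displaystyle\int_0^t\exp\left\{-\int_s^t\frac{\alpha(u)}{T-u}\,\mathrm{d}u\right\}\mathrm{d}B_s & \text{if } t\in[0,T),\\[2mm] 0 & \text{if } t=T,\end{cases}$$ is a centered Gauss process with almost surely continuous paths (on the closed interval $[0,T]$).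
   Context: "Gauss process" means Gaussian process (degenerate Gaussian laws allowed); "centered" means mean zero. For $t\in[0,T)$ the Wiener integral $\int_0^t\exp\{-\int_s^t\frac{\alpha(u)}{T-u}\mathrm{d}u\}\,\mathrm{d}B_s$ is understood as the process $\exp\{-\int_0^t\frac{\alpha(u)}{T-u}\mathrm{d}u\}\int_0^t\exp\{\int_0^s\frac{\alpha(u)}{T-u}\mathrm{d}u\}\,\mathrm{d}B_s$, where the last stochastic integral is taken in its continuous version. The usual conditions: the probability space is complete, the filtration is right-continuous, and $\mathcal{F}_0$ contains all $\mathsf{P}$-null sets. *)

theory Defs
  imports "HOL-Probability.Probability"
begin

section \<open>Filtrations and Wiener processes\<close>

text \<open>The time set of the filtration is \<open>[0,T)\<close>; values of \<open>F\<close> at other reals are irrelevant.\<close>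

definition filtered_prob_space :: "'a measure \<Rightarrow> real \<Rightarrow> (real \<Rightarrow> 'a measure) \<Rightarrow> bool" where
  "filtered_prob_space M T F \<longleftrightarrow>
     prob_space M \<and>
     (\<forall>t\<in>{0..<T}. subalgebra M (F t)) \<and>
     (\<forall>s\<in>{0..<T}. \<forall>t\<in>{0..<T}. s \<le> t \<longrightarrow> sets (F s) \<subseteq> sets (F t))"

definition usual_conditions :: "'a measure \<Rightarrow> real \<Rightarrow> (real \<Rightarrow> 'a measure) \<Rightarrow> bool" where
  "usual_conditions M T F \<longleftrightarrow>
     complete_measure M \<and>
     (\<forall>t\<in>{0..<T}. sets (F t) = (\<Inter>s\<in>{t<..<T}. sets (F s))) \<and>
     null_sets M \<subseteq> sets (F 0)"

definition standard_wiener_process :: "'a measure \<Rightarrow> (real \<Rightarrow> 'a \<Rightarrow> real) \<Rightarrow> bool" where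
  "standard_wiener_process M B \<longleftrightarrow>
     prob_space M \<and>
     (\<forall>t\<ge>0. B t \<in> borel_measurable M) \<and>
     (AE \<omega> in M. B 0 \<omega> = 0) \<and>
     (\<forall>n (p :: nat \<Rightarrow> real). 0 \<le> p 0 \<and> (\<forall>i<n. p i \<le> p (Suc i)) \<longrightarrow>
        prob_space.indep_vars M (\<lambda>_. borel) (\<lambda>i \<omega>. B (p (Suc i)) \<omega> - B (p i) \<omega>) {..<n}) \<and>
     (\<forall>s t. 0 \<le> s \<and> s < t \<longrightarrow>
        distributed M lborel (\<lambda>\<omega>. B t \<omega> - B s \<omega>) (normal_density 0 (sqrt (t - s)))) \<and>
     (AE \<omega> in M. continuous_on {0..} (\<lambda>t. B t \<omega>))"

text \<open>The sigma-algebra at time \<open>t\<close> of the filtration constructed from \<open>B\<close>: the natural one,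
  augmented by the null sets of \<open>M\<close>.\<close>

definition augmented_natural_sets :: "'a measure \<Rightarrow> (real \<Rightarrow> 'a \<Rightarrow> real) \<Rightarrow> real \<Rightarrow> 'a set set" where
  "augmented_natural_sets M B t =
     sigma_sets (space M)
       ((\<Union>s\<in>{0..t}. {B s -` A \<inter> space M |A. A \<in> sets borel}) \<union> null_sets M)"

section \<open>Wiener integrals of deterministic functions\<close>

definition step_function :: "nat \<Rightarrow> (nat \<Rightarrow> real) \<Rightarrow> (nat \<Rightarrow> real) \<Rightarrow> real \<Rightarrow> real" where
  "step_function n p c s = (\<Sum>i<n. c i * indicator {p i<..p (Suc i)} s)"

definition step_integral ::
  "(real \<Rightarrow> 'a \<Rightarrow> real) \<Rightarrow> nat \<Rightarrow> (nat \<Rightarrow> real) \<Rightarrow> (nat \<Rightarrow> real) \<Rightarrow> 'a \<Rightarrow> real" where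
  "step_integral B n p c \<omega> = (\<Sum>i<n. c i * (B (p (Suc i)) \<omega> - B (p i) \<omega>))"

definition is_partition :: "real \<Rightarrow> nat \<Rightarrow> (nat \<Rightarrow> real) \<Rightarrow> bool" where
  "is_partition t n p \<longleftrightarrow> p 0 = 0 \<and> p n = t \<and> (\<forall>i<n. p i \<le> p (Suc i))"

text \<open>\<open>Y\<close> is (a version of) \<open>\<integral>\<^sub>0\<^sup>t f(s) dB\<^sub>s\<close>: the mean-square limit of the integrals of step
  functions approximating \<open>f\<close> in \<open>L\<^sup>2[0,t]\<close>. By the Ito isometry \<open>Y\<close> is unique almost surely.\<close>

definition has_wiener_integral ::
  "'a measure \<Rightarrow> (real \<Rightarrow> 'a \<Rightarrow> real) \<Rightarrow> (real \<Rightarrow> real) \<Rightarrow> real \<Rightarrow> ('a \<Rightarrow> real) \<Rightarrow> bool" where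
  "has_wiener_integral M B f t Y \<longleftrightarrow>
     set_borel_measurable lborel {0..t} f \<and>
     Y \<in> borel_measurable M \<and>
     (\<exists>(n :: nat \<Rightarrow> nat) (p :: nat \<Rightarrow> nat \<Rightarrow> real) (c :: nat \<Rightarrow> nat \<Rightarrow> real).
        (\<forall>k. is_partition t (n k) (p k)) \<and>
        (\<lambda>k. \<integral>\<^sup>+s\<in>{0..t}. ennreal ((f s - step_function (n k) (p k) (c k) s)\<^sup>2) \<partial>lborel)
          \<longlonglongrightarrow> 0 \<and>
        (\<lambda>k. \<integral>\<^sup>+\<omega>. ennreal ((Y \<omega> - step_integral B (n k) (p k) (c k) \<omega>)\<^sup>2) \<partial>M)
          \<longlonglongrightarrow> 0)"

definition is_continuous_wiener_integral ::
  "'a measure \<Rightarrow> (real \<Rightarrow> 'a \<Rightarrow> real) \<Rightarrow> real \<Rightarrow> (real \<Rightarrow> real) \<Rightarrow> (real \<Rightarrow> 'a \<Rightarrow> real) \<Rightarrow> bool" where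
  "is_continuous_wiener_integral M B T f I \<longleftrightarrow>
     (\<forall>t\<in>{0..<T}. has_wiener_integral M B f t (I t)) \<and>
     (AE \<omega> in M. continuous_on {0..<T} (\<lambda>t. I t \<omega>))"

text \<open>The continuous version of \<open>(\<integral>\<^sub>0\<^sup>t f(s) dB\<^sub>s)\<close>, \<open>t \<in> [0,T)\<close>, is unique up to
  indistinguishability; we choose a representative.\<close>

definition wiener_integral ::
  "'a measure \<Rightarrow> (real \<Rightarrow> 'a \<Rightarrow> real) \<Rightarrow> real \<Rightarrow> (real \<Rightarrow> real) \<Rightarrow> real \<Rightarrow> 'a \<Rightarrow> real" where
  "wiener_integral M B T f = (SOME I. is_continuous_wiener_integral M B T f I)"

section \<open>The general alpha-Wiener bridge\<close>

definition alpha_wiener_bridge ::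
  "'a measure \<Rightarrow> (real \<Rightarrow> 'a \<Rightarrow> real) \<Rightarrow> real \<Rightarrow> (real \<Rightarrow> real) \<Rightarrow> real \<Rightarrow> 'a \<Rightarrow> real" where
  "alpha_wiener_bridge M B T \<alpha> t \<omega> =
     (if t < T then
        exp (- integral {0..t} (\<lambda>u. \<alpha> u / (T - u))) *
        wiener_integral M B T (\<lambda>s. exp (integral {0..s} (\<lambda>u. \<alpha> u / (T - u)))) t \<omega>
      else 0)"

section \<open>Gaussian processes\<close>

definition gaussian_rv :: "'a measure \<Rightarrow> ('a \<Rightarrow> real) \<Rightarrow> bool" where
  "gaussian_rv M Y \<longleftrightarrow>
     Y \<in> borel_measurable M \<and>
     ((\<exists>\<mu> \<sigma>. \<sigma> > 0 \<and> distributed M lborel Y (normal_density \<mu> \<sigma>)) \<or>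
      (\<exists>\<mu>. AE \<omega> in M. Y \<omega> = \<mu>))"

text \<open>The finite-dimensional laws are (possibly degenerate) multivariate normal, i.e. every linear
  combination of coordinates is Gaussian, possibly almost surely constant.\<close>

definition gauss_process :: "'a measure \<Rightarrow> 't set \<Rightarrow> ('t \<Rightarrow> 'a \<Rightarrow> real) \<Rightarrow> bool" where
  "gauss_process M I X \<longleftrightarrow>
     (\<forall>t\<in>I. X t \<in> borel_measurable M) \<and>
     (\<forall>J c. finite J \<and> J \<subseteq> I \<longrightarrow> gaussian_rv M (\<lambda>\<omega>. \<Sum>t\<in>J. c t * X t \<omega>))"

definition centered_process :: "'a measure \<Rightarrow> 't set \<Rightarrow> ('t \<Rightarrow> 'a \<Rightarrow> real) \<Rightarrow> bool" where
  "centered_process M I X \<longleftrightarrow> (\<forall>t\<in>I. integrable M (X t) \<and> integral\<^sup>L M (X t) = 0)"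

end

theory Submission
  imports Defs "HOL-Real_Asymp.Real_Asymp"
begin

text \<open>
  Put \<open>A t = \<integral>\<^sub>0\<^sup>t \<alpha>(u)/(T-u) du\<close> and \<open>f = exp A\<close>. As \<open>f\<close> is continuously differentiable on
  \<open>[0,T)\<close>, the continuous version of its Wiener integral is \<open>f t B\<^sub>t - \<integral>\<^sub>0\<^sup>t B\<^sub>s f'(s) ds\<close>, so that
  \<open>X\<^sub>t = B\<^sub>t - (\<integral>\<^sub>0\<^sup>t B\<^sub>s f'(s) ds) / f t\<close> almost surely. Since \<open>\<alpha>(T) > 0\<close>, near \<open>T\<close> the function \<open>f\<close>
  increases to infinity, and l'Hopital's rule makes the quotient converge to \<open>B\<^sub>T\<close>: the path tends to
  \<open>B\<^sub>T - B\<^sub>T = 0\<close>, with no martingale convergence or law of the iterated logarithm involved.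
  Gaussianity holds because mean-square limits of linear combinations of values of \<open>B\<close> are Gaussian.
\<close>

section \<open>Gaussian laws through characteristic functions\<close>

text \<open>The bridge is built from \<open>wiener_integral\<close>, an arbitrary choice among the
  continuous versions of a mean-square limit. Nothing is known about this choice until some
  continuous version is exhibited. Integration by parts exhibits one, and the Ito isometry together
  with continuity carries its formula over to the chosen representative. Path continuity is then a
  deterministic statement about a single continuous function on \<open>[0,T]\<close>:
  \<open>B\<close> runs on all of \<open>[0,\<infinity>)\<close>, so its path is continuous at
  \<open>T\<close> too.

  Gaussianity is read off the mean-square approximation instead. The closed linear span of the
  values of \<open>B\<close> contains every \<open>X t\<close>, hence every linear combination that
  \<open>gauss_process\<close> asks about. Normal densities do not survive a limit in which the
  variance vanishes; the characteristic functions \<open>exp (- (v * u\<^sup>2 / 2))\<close> with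
  \<open>v \<ge> 0\<close> treat degenerate and nondegenerate laws alike.\<close>

lemma (in prob_space) normal_scaled_char:
  assumes "0 < \<sigma>" "distributed M lborel X (normal_density 0 \<sigma>)"
  shows "char (distr M borel X) u = exp (- (\<sigma>\<^sup>2 * u\<^sup>2 / 2))"
proof -
  have X[measurable]: "X \<in> borel_measurable M"
    using distributed_measurable[OF assms(2)] by simp
  have Y: "distributed M lborel (\<lambda>x. X x / \<sigma>) std_normal_density"
    using normal_standard_normal_convert[OF assms(1), of X 0] assms(2) by simp
  have eq: "distr M borel (\<lambda>x. X x / \<sigma>) = std_normal_distribution"
    using distributed_distr_eq_density[OF Y] by (simp cong: distr_cong)
  have "char (distr M borel X) u = (CLINT x|M. iexp (u * X x))"
    by (simp add: char_def integral_distr)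
  also have "\<dots> = (CLINT x|M. iexp ((u * \<sigma>) * (X x / \<sigma>)))"
  proof -
    have "u * \<sigma> * (X x / \<sigma>) = u * X x" for x using assms(1) by simp
    then show ?thesis by presburger
  qed
  also have "\<dots> = char (distr M borel (\<lambda>x. X x / \<sigma>)) (u * \<sigma>)"
    unfolding char_def by (subst integral_distr; (rule refl | simp))
  also have "\<dots> = exp (- (\<sigma>\<^sup>2 * u\<^sup>2 / 2))"
    unfolding eq char_std_normal_distribution
    by (simp add: power_mult_distrib mult.commute)
  finally show ?thesis .
qed

text \<open>The law N(0,v), with \<open>v = 0\<close> for the point mass at 0. Densities would
  separate the two cases, although a mean-square limit can pass from one to the other.\<close>

definition gaussian_char :: "'a measure \<Rightarrow> ('a \<Rightarrow> real) \<Rightarrow> real \<Rightarrow> bool" where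
  "gaussian_char M Y v \<longleftrightarrow> Y \<in> borel_measurable M \<and> 0 \<le> v \<and>
     (\<forall>u. char (distr M borel Y) u = exp (- (v * u\<^sup>2 / 2)))"

text \<open>Levy's uniqueness theorem identifies the law: with a point mass if \<open>v = 0\<close>,
  otherwise with the standard normal law after division by \<open>sqrt v\<close>.\<close>

lemma (in prob_space) gaussian_char_imp_gaussian:
  assumes "gaussian_char M Y v"
  shows "gaussian_rv M Y" "integrable M Y" "expectation Y = 0"
proof -
  have Y[measurable]: "Y \<in> borel_measurable M" and v: "0 \<le> v"
    and ch: "\<And>u. char (distr M borel Y) u = exp (- (v * u\<^sup>2 / 2))"
    using assms by (auto simp: gaussian_char_def)
  have "gaussian_rv M Y \<and> integrable M Y \<and> expectation Y = 0"
  proof (cases "v = 0")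
    case True
    interpret R: prob_space "return borel (0::real)"
      by (rule prob_space_return) simp
    have "char (return borel (0::real)) u = 1" for u
      unfolding char_def by (subst integral_return) auto
    then have "char (distr M borel Y) = char (return borel 0)"
      using ch True by (intro ext) simp
    then have eq: "distr M borel Y = return borel 0"
      by (intro Levy_uniqueness real_distribution_distr)
         (auto simp: real_distribution_def real_distribution_axioms_def R.prob_space_axioms)
    have "AE x in distr M borel Y. x = 0"
      unfolding eq by (subst AE_return) auto
    then have ae: "AE \<omega> in M. Y \<omega> = 0"
      by (subst (asm) AE_distr_iff) auto
    have "integrable M Y \<longleftrightarrow> integrable M (\<lambda>_. 0::real)"
      by (rule integrable_cong_AE) (use ae in auto)
    moreover have "expectation Y = expectation (\<lambda>_. 0)"
      by (rule integral_cong_AE) (use ae in auto)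
    ultimately show ?thesis
      using ae by (auto simp: gaussian_rv_def)
  next
    case False
    define \<sigma> where "\<sigma> = sqrt v"
    have s: "0 < \<sigma>" "\<sigma>\<^sup>2 = v" using v False by (auto simp: \<sigma>_def)
    have "char (distr M borel (\<lambda>\<omega>. Y \<omega> / \<sigma>)) u = char std_normal_distribution u" for u
    proof -
      have "char (distr M borel (\<lambda>\<omega>. Y \<omega> / \<sigma>)) u = char (distr M borel Y) (u / \<sigma>)"
        by (simp add: char_def integral_distr)
      also have "\<dots> = exp (- (u\<^sup>2 / 2))"
        using s v False by (simp add: ch power_divide)
      finally show ?thesis by (simp add: char_std_normal_distribution)
    qed
    then have "distr M borel (\<lambda>\<omega>. Y \<omega> / \<sigma>) = std_normal_distribution"
      by (intro Levy_uniqueness real_distribution_distr real_dist_normal_dist) auto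
    then have "distributed M lborel (\<lambda>\<omega>. Y \<omega> / \<sigma>) std_normal_density"
      by (auto simp: distributed_def cong: distr_cong)
    then have D: "distributed M lborel Y (normal_density 0 \<sigma>)"
      using normal_standard_normal_convert[OF s(1), of Y 0] by simp
    have "integrable lborel (\<lambda>x. normal_density 0 \<sigma> x * x)"
      using integrable_normal_moment[OF s(1), of 0 1] by simp
    then have "integrable M Y"
      using distributed_integrable[OF D, of "\<lambda>x. x"] by (simp add: normal_density_nonneg)
    then show ?thesis
      using D s normal_distributed_expectation[OF s(1) D] by (auto simp: gaussian_rv_def)
  qed
  then show "gaussian_rv M Y" "integrable M Y" "expectation Y = 0" by auto
qed

text \<open>The map \<open>x \<mapsto> iexp (u * x)\<close> is Lipschitz with constant
  \<open>\<bar>u\<bar>\<close>, and on a probability space the L1 norm is bounded by the L2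
  norm.\<close>

lemma (in prob_space) char_distr_diff_le:
  assumes [measurable]: "Y \<in> borel_measurable M" "Z \<in> borel_measurable M"
    and sq: "integrable M (\<lambda>\<omega>. (Y \<omega> - Z \<omega>)\<^sup>2)"
  shows "cmod (char (distr M borel Y) u - char (distr M borel Z) u)
    \<le> \<bar>u\<bar> * sqrt (expectation (\<lambda>\<omega>. (Y \<omega> - Z \<omega>)\<^sup>2))"
proof -
  let ?D = "\<lambda>\<omega>. \<bar>Y \<omega> - Z \<omega>\<bar>"
  have int: "integrable M ?D"
  proof (rule Bochner_Integration.integrable_bound[where f="\<lambda>\<omega>. 1 + (Y \<omega> - Z \<omega>)\<^sup>2"])
    \<comment> \<open>The square of \<open>\<bar>x\<bar> - 1\<close> is nonnegative, which gives
      even \<open>2 * \<bar>x\<bar> \<le> 1 + x\<^sup>2\<close>.\<close>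
    have "\<bar>x\<bar> \<le> 1 + x\<^sup>2" for x :: real
      using zero_le_power2[of "\<bar>x\<bar> - 1"] by (simp add: power2_diff)
    then show "AE \<omega> in M. norm (?D \<omega>) \<le> norm (1 + (Y \<omega> - Z \<omega>)\<^sup>2)" by simp
  qed (use sq in auto)
  \<comment> \<open>Cauchy-Schwarz in the form that the variance of \<open>?D\<close> is
    nonnegative.\<close>
  have "(expectation ?D)\<^sup>2 \<le> expectation (\<lambda>\<omega>. (Y \<omega> - Z \<omega>)\<^sup>2)"
    using variance_eq[OF int] variance_positive[of ?D] sq by simp
  then have L1: "expectation ?D \<le> sqrt (expectation (\<lambda>\<omega>. (Y \<omega> - Z \<omega>)\<^sup>2))"
    by (rule real_le_rsqrt)
  have lip: "cmod (iexp (u * a) - iexp (u * b)) \<le> \<bar>u\<bar> * \<bar>a - b\<bar>" for a b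
  proof -
    have "iexp (u * a) - iexp (u * b) = iexp (u * b) * (iexp (u * (a - b)) - 1)"
      by (simp add: algebra_simps flip: exp_add)
    then have "cmod (iexp (u * a) - iexp (u * b)) = cmod (iexp (u * (a - b)) - 1)"
      by (simp add: norm_mult del: of_real_mult)
    also have "\<dots> \<le> \<bar>u * (a - b)\<bar>"
      using iexp_approx1[of "u * (a - b)" 0] by simp
    finally show ?thesis by (simp add: abs_mult)
  qed
  have iY: "integrable M (\<lambda>\<omega>. iexp (u * Y \<omega>))" and iZ: "integrable M (\<lambda>\<omega>. iexp (u * Z \<omega>))"
    by (rule integrable_const_bound[where B=1]; auto simp del: of_real_mult)+
  have "char (distr M borel Y) u - char (distr M borel Z) u
      = (CLINT \<omega>|M. iexp (u * Y \<omega>) - iexp (u * Z \<omega>))"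
    using iY iZ by (simp add: char_def integral_distr)
  also have "cmod \<dots> \<le> (LINT \<omega>|M. cmod (iexp (u * Y \<omega>) - iexp (u * Z \<omega>)))"
    by (rule integral_norm_bound)
  also have "\<dots> \<le> (LINT \<omega>|M. \<bar>u\<bar> * ?D \<omega>)"
    using iY iZ int lip by (intro integral_mono) (auto simp del: of_real_mult)
  also have "\<dots> \<le> \<bar>u\<bar> * sqrt (expectation (\<lambda>\<omega>. (Y \<omega> - Z \<omega>)\<^sup>2))"
    using L1 by (simp add: mult_left_mono)
  finally show ?thesis .
qed

text \<open>The characteristic functions converge pointwise. A single point
  \<open>w \<noteq> 0\<close> at which the limit does not vanish determines the limit of the
  variances, and with it the limit function everywhere.\<close>

lemma (in prob_space) gaussian_char_limit:
  assumes Z: "\<And>k. \<exists>v. gaussian_char M (Z k) v"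
    and Y[measurable]: "Y \<in> borel_measurable M"
    and lim: "(\<lambda>k. \<integral>\<^sup>+\<omega>. ennreal ((Y \<omega> - Z k \<omega>)\<^sup>2) \<partial>M) \<longlonglongrightarrow> 0"
  shows "\<exists>v. gaussian_char M Y v"
proof -
  obtain v where v: "\<And>k. gaussian_char M (Z k) (v k)" using Z by metis
  then have Zm[measurable]: "\<And>k. Z k \<in> borel_measurable M" and v0: "\<And>k. 0 \<le> v k"
    and ch: "\<And>k u. char (distr M borel (Z k)) u = exp (- (v k * u\<^sup>2 / 2))"
    by (auto simp: gaussian_char_def)
  interpret D: real_distribution "distr M borel Y" by (rule real_distribution_distr) simp
  define \<phi> where "\<phi> = char (distr M borel Y)"
  have conv: "(\<lambda>k. complex_of_real (exp (- (v k * u\<^sup>2 / 2)))) \<longlonglongrightarrow> \<phi> u" for u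
  proof -
    define e where "e k = enn2real (\<integral>\<^sup>+\<omega>. ennreal ((Y \<omega> - Z k \<omega>)\<^sup>2) \<partial>M)" for k
    have e0: "e \<longlonglongrightarrow> 0"
      unfolding e_def using tendsto_enn2real[OF lim[folded ennreal_0]] by simp
    \<comment> \<open>A finite mean-square distance, hence an integrable square, is available only
      from some \<open>k\<close> on; the bound 1 is arbitrary.\<close>
    have "eventually (\<lambda>k. (\<integral>\<^sup>+\<omega>. ennreal ((Y \<omega> - Z k \<omega>)\<^sup>2) \<partial>M) < 1) sequentially"
      using order_tendstoD(2)[OF lim, of 1] by simp
    then have "eventually (\<lambda>k. cmod (complex_of_real (exp (- (v k * u\<^sup>2 / 2))) - \<phi> u) \<le> \<bar>u\<bar> * sqrt (e k)) sequentially"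
    proof eventually_elim
      case (elim k)
      have int: "integrable M (\<lambda>\<omega>. (Y \<omega> - Z k \<omega>)\<^sup>2)"
        using elim by (intro integrableI_nonneg) (auto intro: less_trans)
      have "expectation (\<lambda>\<omega>. (Y \<omega> - Z k \<omega>)\<^sup>2) = e k"
        unfolding e_def by (rule integral_eq_nn_integral) auto
      then show ?case
        using char_distr_diff_le[OF Y Zm int, of u]
        by (simp add: \<phi>_def ch norm_minus_commute)
    qed
    moreover have "(\<lambda>k. \<bar>u\<bar> * sqrt (e k)) \<longlonglongrightarrow> 0"
      using tendsto_mult_right_zero[OF tendsto_real_sqrt[OF e0, simplified]] by simp
    ultimately have "(\<lambda>k. complex_of_real (exp (- (v k * u\<^sup>2 / 2))) - \<phi> u) \<longlonglongrightarrow> 0"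
      by (rule Lim_null_comparison)
    then show ?thesis by (simp add: LIM_zero_iff)
  qed
  \<comment> \<open>Continuity and \<open>\<phi> 0 = 1\<close> keep \<open>\<phi> w\<close> within
    distance 1 of 1 for some \<open>w > 0\<close>. Its real part is then nonzero, which rules out
    \<open>v k\<close> tending to infinity and lets the logarithm pass to the limit.\<close>
  have "isCont \<phi> 0" unfolding \<phi>_def by (rule D.isCont_char)
  moreover have "\<phi> 0 = 1" unfolding \<phi>_def by (rule D.char_zero)
  ultimately obtain d where d: "d > 0" "\<And>u. dist u 0 < d \<Longrightarrow> dist (\<phi> u) 1 < 1"
    unfolding continuous_at_eps_delta by (metis zero_less_one)
  define w where "w = d / 2"
  have w: "w > 0" "dist (\<phi> w) 1 < 1" using d by (auto simp: w_def)
  have re: "(\<lambda>k. exp (- (v k * w\<^sup>2 / 2))) \<longlonglongrightarrow> Re (\<phi> w)"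
    using tendsto_Re[OF conv[of w]] by simp
  have "\<bar>Re (\<phi> w - 1)\<bar> < 1"
    using w(2) abs_Re_le_cmod[of "\<phi> w - 1"] by (simp add: dist_norm)
  then have pos: "Re (\<phi> w) \<noteq> 0" by auto
  define V where "V = - 2 / w\<^sup>2 * ln (Re (\<phi> w))"
  have "(\<lambda>k. - 2 / w\<^sup>2 * ln (exp (- (v k * w\<^sup>2 / 2)))) \<longlonglongrightarrow> V"
    unfolding V_def by (intro tendsto_intros re pos)
  then have vV: "v \<longlonglongrightarrow> V" using w by simp
  have "\<phi> u = complex_of_real (exp (- (V * u\<^sup>2 / 2)))" for u
    by (rule LIMSEQ_unique[OF conv]) (intro tendsto_intros vV, simp_all)
  moreover have "0 \<le> V" by (rule LIMSEQ_le_const[OF vV]) (use v0 in auto)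
  ultimately show ?thesis unfolding gaussian_char_def \<phi>_def by (intro exI[of _ V]) simp
qed

section \<open>Linear combinations of values of a Wiener process\<close>

lemma wiener_process_measurable:
  assumes "standard_wiener_process M B" "0 \<le> t"
  shows "B t \<in> borel_measurable M"
  using assms unfolding standard_wiener_process_def by auto

lemma wiener_increment_char:
  assumes W: "standard_wiener_process M B" and st: "0 \<le> s" "s \<le> t"
  shows "char (distr M borel (\<lambda>\<omega>. c * (B t \<omega> - B s \<omega>))) u = exp (- ((t - s) * c\<^sup>2 * u\<^sup>2 / 2))"
proof -
  interpret prob_space M using W by (simp add: standard_wiener_process_def)
  have [measurable]: "B s \<in> borel_measurable M" "B t \<in> borel_measurable M"
    using W st by (auto intro: wiener_process_measurable)
  have "char (distr M borel (\<lambda>\<omega>. c * (B t \<omega> - B s \<omega>))) u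
      = char (distr M borel (\<lambda>\<omega>. B t \<omega> - B s \<omega>)) (u * c)"
    by (simp add: char_def integral_distr algebra_simps)
  also have "\<dots> = exp (- ((t - s) * c\<^sup>2 * u\<^sup>2 / 2))"
  \<comment> \<open>A Wiener process has normal densities only for \<open>s < t\<close>; the zero
    increment has characteristic function 1.\<close>
  proof (cases "s = t")
    case True
    then show ?thesis by (simp add: char_def integral_distr prob_space del: distr_const)
  next
    case False
    then have "distributed M lborel (\<lambda>\<omega>. B t \<omega> - B s \<omega>) (normal_density 0 (sqrt (t - s)))"
      using W st by (simp add: standard_wiener_process_def)
    with False st show ?thesis
      by (subst normal_scaled_char) (auto simp: power_mult_distrib mult_ac)
  qed
  finally show ?thesis .
qed

text \<open>A list of coefficient-time pairs makes addition a concatenation and lets times repeat,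
  so no two index sets have to be merged.\<close>

definition wiener_combination :: "(real \<Rightarrow> 'a \<Rightarrow> real) \<Rightarrow> ('a \<Rightarrow> real) \<Rightarrow> bool" where
  "wiener_combination B Z \<longleftrightarrow>
     (\<exists>xs. (\<forall>(c, s)\<in>set xs. 0 \<le> s) \<and> Z = (\<lambda>\<omega>. \<Sum>(c, s)\<leftarrow>xs. c * B s \<omega>))"

lemma wiener_combination_zero: "wiener_combination B (\<lambda>_. 0)"
  unfolding wiener_combination_def by (rule exI[of _ "[]"]) simp

lemma wiener_combination_single: "0 \<le> s \<Longrightarrow> wiener_combination B (B s)"
  unfolding wiener_combination_def by (rule exI[of _ "[(1, s)]"]) simp

lemma wiener_combination_scale:
  assumes "wiener_combination B Z" shows "wiener_combination B (\<lambda>\<omega>. a * Z \<omega>)"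
proof -
  obtain xs where xs: "\<forall>(c, s)\<in>set xs. 0 \<le> s" "Z = (\<lambda>\<omega>. \<Sum>(c, s)\<leftarrow>xs. c * B s \<omega>)"
    using assms unfolding wiener_combination_def by auto
  show ?thesis
    unfolding wiener_combination_def
    using xs by (intro exI[of _ "map (\<lambda>(c, s). (a * c, s)) xs"])
      (auto simp: sum_list_const_mult[symmetric] comp_def case_prod_unfold mult.assoc)
qed

lemma wiener_combination_add:
  assumes "wiener_combination B Z" "wiener_combination B Z'"
  shows "wiener_combination B (\<lambda>\<omega>. Z \<omega> + Z' \<omega>)"
proof -
  obtain xs where xs: "\<forall>(c, s)\<in>set xs. 0 \<le> s" "Z = (\<lambda>\<omega>. \<Sum>(c, s)\<leftarrow>xs. c * B s \<omega>)"
    using assms unfolding wiener_combination_def by auto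
  obtain ys where ys: "\<forall>(c, s)\<in>set ys. 0 \<le> s" "Z' = (\<lambda>\<omega>. \<Sum>(c, s)\<leftarrow>ys. c * B s \<omega>)"
    using assms unfolding wiener_combination_def by auto
  show ?thesis
    unfolding wiener_combination_def
    using xs ys by (intro exI[of _ "xs @ ys"]) auto
qed

lemma wiener_combination_sum:
  assumes "finite I" "\<And>i. i \<in> I \<Longrightarrow> wiener_combination B (Z i)"
  shows "wiener_combination B (\<lambda>\<omega>. \<Sum>i\<in>I. Z i \<omega>)"
  using assms
  by (induction I rule: finite_induct) (auto intro!: wiener_combination_zero wiener_combination_add)

text \<open>Sorting the times writes the combination through successive increments, which are independent;
  repeated times only produce zero increments.\<close>

lemma wiener_combination_gaussian:
  assumes W: "standard_wiener_process M B" and Z: "wiener_combination B Z"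
  shows "\<exists>v. gaussian_char M Z v"
proof -
  interpret prob_space M using W by (simp add: standard_wiener_process_def)
  obtain xs0 where xs0: "\<forall>(c, s)\<in>set xs0. 0 \<le> s" "Z = (\<lambda>\<omega>. \<Sum>(c, s)\<leftarrow>xs0. c * B s \<omega>)"
    using Z unfolding wiener_combination_def by auto
  define xs where "xs = sort_key snd xs0"
  have "mset xs = mset xs0" by (simp add: xs_def)
  then have "mset (map (\<lambda>(c, s). c * B s \<omega>) xs) = mset (map (\<lambda>(c, s). c * B s \<omega>) xs0)" for \<omega>
    by simp
  then have Zxs: "Z = (\<lambda>\<omega>. \<Sum>(c, s)\<leftarrow>xs. c * B s \<omega>)"
    unfolding xs0(2) by (intro ext) (metis sum_mset_sum_list)
  have pos: "0 \<le> snd (xs ! i)" if "i < length xs" for i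
  proof -
    have "xs ! i \<in> set xs0" using that nth_mem[OF that] by (simp add: xs_def)
    then show ?thesis using xs0(1) by (auto simp: case_prod_unfold)
  qed
  have sorted: "sorted (map snd xs)" by (simp add: xs_def)
  define n where "n = length xs"
  define c where "c i = fst (xs ! i)" for i
  \<comment> \<open>Time 0 is put in front of the sorted times, so that the increments telescope
    from \<open>B 0\<close>, which vanishes almost surely.\<close>
  define p where "p i = (case i of 0 \<Rightarrow> 0 | Suc j \<Rightarrow> snd (xs ! j))" for i
  have p_le: "p i \<le> p (Suc i)" if "i < n" for i
    using that pos sorted by (cases i) (auto simp: p_def n_def sorted_iff_nth_mono)
  have p0: "0 \<le> p i" if "i \<le> n" for i
    using that pos by (cases i) (auto simp: p_def n_def)
  have Zn: "Z \<omega> = (\<Sum>i<n. c i * B (p (Suc i)) \<omega>)" for \<omega>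
    by (simp add: Zxs sum_list_sum_nth n_def c_def p_def case_prod_unfold atLeast0LessThan)
  have Bm[measurable]: "B (p i) \<in> borel_measurable M" if "i \<le> n" for i
    using wiener_process_measurable[OF W] p0 that by auto
  define \<Delta> where "\<Delta> i \<omega> = B (p (Suc i)) \<omega> - B (p i) \<omega>" for i \<omega>
  \<comment> \<open>Abel summation: \<open>B (p (Suc i))\<close> contains the increments with index
    up to \<open>i\<close>, so increment \<open>j\<close> collects the tail of the
    coefficients.\<close>
  define d where "d j = (\<Sum>i<n. if j \<le> i then c i else 0)" for j
  have indep: "indep_vars (\<lambda>_. borel) \<Delta> {..<n}"
    using W p_le unfolding standard_wiener_process_def \<Delta>_def
    by (auto simp: p_def[of 0])
  have "AE \<omega> in M. B 0 \<omega> = 0" using W by (simp add: standard_wiener_process_def)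
  then have ae: "AE \<omega> in M. Z \<omega> = (\<Sum>j<n. d j * \<Delta> j \<omega>)"
  proof eventually_elim
    case (elim \<omega>)
    have tele: "B (p (Suc i)) \<omega> = (\<Sum>j<n. if j \<le> i then \<Delta> j \<omega> else 0)" if "i < n" for i
    proof -
      have "(\<Sum>j<n. if j \<le> i then \<Delta> j \<omega> else 0) = (\<Sum>j<Suc i. \<Delta> j \<omega>)"
        using that by (intro sum.mono_neutral_cong_right) auto
      also have "\<dots> = B (p (Suc i)) \<omega>"
        unfolding \<Delta>_def using elim by (subst sum_lessThan_telescope) (simp add: p_def[of 0])
      finally show ?thesis by simp
    qed
    have "Z \<omega> = (\<Sum>i<n. \<Sum>j<n. c i * (if j \<le> i then \<Delta> j \<omega> else 0))"
      unfolding Zn by (intro sum.cong refl) (simp add: tele sum_distrib_left)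
    also have "\<dots> = (\<Sum>j<n. d j * \<Delta> j \<omega>)"
      unfolding d_def by (subst sum.swap) (auto simp: sum_distrib_right intro!: sum.cong)
    finally show ?case .
  qed
  have \<Delta>m[measurable]: "\<Delta> j \<in> borel_measurable M" if "j < n" for j
    using that unfolding \<Delta>_def by (intro borel_measurable_diff Bm) auto
  have Zm[measurable]: "Z \<in> borel_measurable M"
    unfolding Zn by (intro borel_measurable_sum borel_measurable_times borel_measurable_const Bm) auto
  define v where "v = (\<Sum>j<n. (p (Suc j) - p j) * (d j)\<^sup>2)"
  have "char (distr M borel Z) u = exp (- (v * u\<^sup>2 / 2))" for u
  proof -
    have "distr M borel Z = distr M borel (\<lambda>\<omega>. \<Sum>j<n. d j * \<Delta> j \<omega>)"
      using ae by (intro distr_cong_AE) auto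
    also have "char \<dots> u = (\<Prod>j<n. char (distr M borel (\<lambda>\<omega>. d j * \<Delta> j \<omega>)) u)"
      by (rule char_distr_sum, rule indep_vars_compose2[OF indep]) auto
    also have "\<dots> = (\<Prod>j<n. complex_of_real (exp (- ((p (Suc j) - p j) * (d j)\<^sup>2 * u\<^sup>2 / 2))))"
      unfolding \<Delta>_def using p_le p0
      by (intro prod.cong refl wiener_increment_char[OF W]) auto
    also have "\<dots> = exp (- (v * u\<^sup>2 / 2))"
      unfolding v_def of_real_prod[symmetric] exp_sum[OF finite_lessThan, symmetric]
      by (simp add: sum_negf sum_divide_distrib sum_distrib_right)
    finally show ?thesis .
  qed
  moreover have "0 \<le> v" unfolding v_def using p_le by (intro sum_nonneg) auto
  ultimately show ?thesis unfolding gaussian_char_def by auto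
qed

section \<open>The Ito isometry and uniqueness of the Wiener integral\<close>

text \<open>The absolute value admits both orders of the times: polarization compares endpoints of
  two intervals whose order is unknown.\<close>

lemma wiener_increment_square:
  assumes W: "standard_wiener_process M B" and st: "0 \<le> s" "0 \<le> t"
  shows "integrable M (\<lambda>\<omega>. (B t \<omega> - B s \<omega>)\<^sup>2)"
    and "(LINT \<omega>|M. (B t \<omega> - B s \<omega>)\<^sup>2) = \<bar>t - s\<bar>"
proof -
  interpret prob_space M using W by (simp add: standard_wiener_process_def)
  have *: "integrable M (\<lambda>\<omega>. (B t \<omega> - B s \<omega>)\<^sup>2) \<and> expectation (\<lambda>\<omega>. (B t \<omega> - B s \<omega>)\<^sup>2) = t - s"
    if "0 \<le> s" "s < t" for s t
  proof -
    have D: "distributed M lborel (\<lambda>\<omega>. B t \<omega> - B s \<omega>) (normal_density 0 (sqrt (t - s)))"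
      using W that by (simp add: standard_wiener_process_def)
    have pos: "0 < sqrt (t - s)" using that by simp
    have "integrable lborel (\<lambda>x. normal_density 0 (sqrt (t - s)) x * x\<^sup>2)"
      using integrable_normal_moment[OF pos, of 0 2] by simp
    then have "integrable M (\<lambda>\<omega>. (B t \<omega> - B s \<omega>)\<^sup>2)"
      using distributed_integrable[OF D, of "\<lambda>x. x\<^sup>2"] by simp
    then show ?thesis
      using normal_distributed_variance[OF pos D] normal_distributed_expectation[OF pos D] that
      by simp
  qed
  have "integrable M (\<lambda>\<omega>. (B t \<omega> - B s \<omega>)\<^sup>2)
      \<and> expectation (\<lambda>\<omega>. (B t \<omega> - B s \<omega>)\<^sup>2) = \<bar>t - s\<bar>"
    using *[of s t] *[of t s] st
    by (cases s t rule: linorder_cases) (auto simp: power2_commute[of "B t _"])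
  then show "integrable M (\<lambda>\<omega>. (B t \<omega> - B s \<omega>)\<^sup>2)"
    "(LINT \<omega>|M. (B t \<omega> - B s \<omega>)\<^sup>2) = \<bar>t - s\<bar>" by auto
qed

text \<open>By polarization: with \<open>x = B b - B a\<close> and \<open>y = B d - B c\<close> one has
  \<open>2 x y = (B b - B c)\<^sup>2 + (B a - B d)\<^sup>2 - (B b - B d)\<^sup>2 - (B a - B c)\<^sup>2\<close>, so only the variances of
  the increments enter.\<close>

lemma wiener_increments_inner:
  assumes W: "standard_wiener_process M B" and "0 \<le> a" "a \<le> b" "0 \<le> c" "c \<le> d"
  shows "has_bochner_integral M (\<lambda>\<omega>. (B b \<omega> - B a \<omega>) * (B d \<omega> - B c \<omega>))
    (LINT s|lborel. indicator {a<..b} s * indicator {c<..d} s)"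
proof -
  have hb: "has_bochner_integral M (\<lambda>\<omega>. (B t \<omega> - B s \<omega>)\<^sup>2) \<bar>t - s\<bar>" if "0 \<le> s" "0 \<le> t" for s t
    using wiener_increment_square[OF W that] by (simp add: has_bochner_integral_iff)
  have "has_bochner_integral M (\<lambda>\<omega>. ((B b \<omega> - B c \<omega>)\<^sup>2 + (B a \<omega> - B d \<omega>)\<^sup>2
      - (B b \<omega> - B d \<omega>)\<^sup>2 - (B a \<omega> - B c \<omega>)\<^sup>2) / 2) ((\<bar>b - c\<bar> + \<bar>a - d\<bar> - \<bar>b - d\<bar> - \<bar>a - c\<bar>) / 2)"
    using assms by (intro has_bochner_integral_divide_zero has_bochner_integral_diff has_bochner_integral_add hb) auto
  also have "(\<lambda>\<omega>. ((B b \<omega> - B c \<omega>)\<^sup>2 + (B a \<omega> - B d \<omega>)\<^sup>2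
      - (B b \<omega> - B d \<omega>)\<^sup>2 - (B a \<omega> - B c \<omega>)\<^sup>2) / 2) = (\<lambda>\<omega>. (B b \<omega> - B a \<omega>) * (B d \<omega> - B c \<omega>))"
    by (intro ext) (simp add: power2_eq_square field_simps)
  \<comment> \<open>Half the alternating sum of distances is the length of the overlap
    \<open>{max a c<..min b d}\<close>.\<close>
  also have "(\<bar>b - c\<bar> + \<bar>a - d\<bar> - \<bar>b - d\<bar> - \<bar>a - c\<bar>) / 2
      = (LINT s|lborel. indicator {a<..b} s * indicator {c<..d} s)"
  proof -
    have "(LINT s|lborel. indicator {a<..b} s * indicator {c<..d} s)
        = (LINT s|lborel. indicat_real {max a c<..min b d} s)"
      by (intro Bochner_Integration.integral_cong) (auto simp: indicator_def)
    also have "\<dots> = measure lborel {max a c<..min b d}" by simp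
    also have "\<dots> = (if max a c \<le> min b d then min b d - max a c else 0)"
      by auto
    finally show ?thesis using assms by (auto simp: min_def max_def)
  qed
  finally show ?thesis .
qed

lemma is_partition_nonneg:
  assumes "is_partition t n p" "i \<le> n"
  shows "0 \<le> p i"
  using assms(2)
proof (induction i)
  case 0 then show ?case using assms by (simp add: is_partition_def)
next
  case (Suc i) then show ?case using assms(1) by (auto simp: is_partition_def intro: order_trans)
qed

text \<open>Bilinearity reduces the isometry to pairs of intervals. As these may overlap in any way,
  the two partitions can be unrelated and no common refinement is formed.\<close>

lemma step_integral_inner:
  assumes W: "standard_wiener_process M B"
    and p: "is_partition t n p" and q: "is_partition t' m q"
  shows "has_bochner_integral M (\<lambda>\<omega>. step_integral B n p c \<omega> * step_integral B m q d \<omega>)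
    (LINT s|lborel. step_function n p c s * step_function m q d s)"
    and "integrable lborel (\<lambda>s. step_function n p c s * step_function m q d s)"
proof -
  have inc: "has_bochner_integral M
      (\<lambda>\<omega>. (B (p (Suc i)) \<omega> - B (p i) \<omega>) * (B (q (Suc j)) \<omega> - B (q j) \<omega>))
      (LINT s|lborel. indicator {p i<..p (Suc i)} s * indicator {q j<..q (Suc j)} s)"
    if "i < n" "j < m" for i j
    using that is_partition_nonneg[OF p, of i] is_partition_nonneg[OF q, of j] p q
    by (intro wiener_increments_inner[OF W]) (auto simp: is_partition_def)
  have indint: "integrable lborel (\<lambda>s. indicat_real {p i<..p (Suc i)} s * indicator {q j<..q (Suc j)} s)" for i j
    by (cases "p i \<le> p (Suc i)"; intro integrable_real_mult_indicator integrable_real_indicator) auto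
  have F: "(\<lambda>s. step_function n p c s * step_function m q d s) = (\<lambda>s. \<Sum>i<n. \<Sum>j<m. (c i * d j) *
      (indicator {p i<..p (Suc i)} s * indicator {q j<..q (Suc j)} s))"
    by (intro ext) (simp only: step_function_def sum_product mult_ac)
  show "integrable lborel (\<lambda>s. step_function n p c s * step_function m q d s)"
    unfolding F by (intro Bochner_Integration.integrable_sum integrable_mult_right indint)
  have S: "(\<lambda>\<omega>. step_integral B n p c \<omega> * step_integral B m q d \<omega>) = (\<lambda>\<omega>. \<Sum>i<n. \<Sum>j<m. (c i * d j) *
      ((B (p (Suc i)) \<omega> - B (p i) \<omega>) * (B (q (Suc j)) \<omega> - B (q j) \<omega>)))"
    by (intro ext) (simp add: step_integral_def sum_product mult_ac)
  have "(LINT s|lborel. step_function n p c s * step_function m q d s) = (\<Sum>i<n. \<Sum>j<m. (c i * d j) *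
      (LINT s|lborel. indicator {p i<..p (Suc i)} s * indicator {q j<..q (Suc j)} s))"
    unfolding F
    by (simp add: Bochner_Integration.integral_sum Bochner_Integration.integrable_sum indint)
  then show "has_bochner_integral M (\<lambda>\<omega>. step_integral B n p c \<omega> * step_integral B m q d \<omega>)
    (LINT s|lborel. step_function n p c s * step_function m q d s)"
    unfolding S by (simp only:) (intro has_bochner_integral_sum has_bochner_integral_mult_right inc; simp)
qed

text \<open>This reconciles inner products over the whole line with the integrals over
  \<open>{0..t}\<close> in \<open>has_wiener_integral\<close>.\<close>

lemma step_function_eq_0:
  assumes "is_partition t n p" "s \<notin> {0..t}"
  shows "step_function n p c s = 0"
proof -
  have mono: "p i \<le> p j" if "i \<le> j" "j \<le> n" for i j
    using that by (induction rule: dec_induct) (use assms(1) in \<open>auto simp: is_partition_def intro: order_trans\<close>)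
  have "s \<notin> {p i<..p (Suc i)}" if "i < n" for i
    using mono[of 0 i] mono[of "Suc i" n] that assms by (auto simp: is_partition_def)
  then show ?thesis by (auto simp: step_function_def intro!: sum.neutral)
qed

lemma borel_measurable_step_function[measurable]: "step_function n p c \<in> borel_measurable borel"
  unfolding step_function_def by measurable

lemma borel_measurable_step_integral:
  assumes W: "standard_wiener_process M B" and p: "is_partition t n p"
  shows "step_integral B n p c \<in> borel_measurable M"
  unfolding step_integral_def
  by (intro borel_measurable_sum borel_measurable_times borel_measurable_diff borel_measurable_const
      wiener_process_measurable[OF W] is_partition_nonneg[OF p]) auto

lemma wiener_combination_step_integral:
  assumes p: "is_partition t n p"
  shows "wiener_combination B (step_integral B n p c)"
proof -
  have "wiener_combination B (\<lambda>\<omega>. \<Sum>i<n. c i * (B (p (Suc i)) \<omega> + (-1) * B (p i) \<omega>))"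
    by (intro wiener_combination_sum wiener_combination_scale wiener_combination_add
        wiener_combination_single is_partition_nonneg[OF p]) auto
  then show ?thesis by (simp add: step_integral_def[abs_def])
qed

text \<open>Rewriting the difference as one step function would again take a common refinement.
  Expanding the square leaves three inner products, which agree on both sides.\<close>

lemma step_integral_isometry:
  assumes W: "standard_wiener_process M B"
    and p: "is_partition t n p" and q: "is_partition t m q"
  shows "(\<integral>\<^sup>+\<omega>. ennreal ((step_integral B n p c \<omega> - step_integral B m q d \<omega>)\<^sup>2) \<partial>M)
    = (\<integral>\<^sup>+s\<in>{0..t}. ennreal ((step_function n p c s - step_function m q d s)\<^sup>2) \<partial>lborel)"
proof -
  let ?S = "step_integral B n p c" and ?R = "step_integral B m q d"
  let ?f = "step_function n p c" and ?g = "step_function m q d"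
  have hS: "has_bochner_integral M (\<lambda>\<omega>. (?S \<omega> * ?S \<omega> + ?R \<omega> * ?R \<omega>) - (?S \<omega> * ?R \<omega> + ?S \<omega> * ?R \<omega>))
     (((LINT s|lborel. ?f s * ?f s) + (LINT s|lborel. ?g s * ?g s))
        - ((LINT s|lborel. ?f s * ?g s) + (LINT s|lborel. ?f s * ?g s)))"
    by (intro has_bochner_integral_diff has_bochner_integral_add
        step_integral_inner(1)[OF W p p] step_integral_inner(1)[OF W q q] step_integral_inner(1)[OF W p q])
  have hf: "has_bochner_integral lborel (\<lambda>s. (?f s * ?f s + ?g s * ?g s) - (?f s * ?g s + ?f s * ?g s))
     (((LINT s|lborel. ?f s * ?f s) + (LINT s|lborel. ?g s * ?g s))
        - ((LINT s|lborel. ?f s * ?g s) + (LINT s|lborel. ?f s * ?g s)))"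
    by (intro has_bochner_integral_diff has_bochner_integral_add has_bochner_integral_integrable
        step_integral_inner(2)[OF W p p] step_integral_inner(2)[OF W q q] step_integral_inner(2)[OF W p q])
  have sq: "(x - y)\<^sup>2 = (x * x + y * y) - (x * y + x * y)" for x y :: real
    by (simp add: power2_eq_square algebra_simps)
  have "(\<integral>\<^sup>+\<omega>. ennreal ((?S \<omega> - ?R \<omega>)\<^sup>2) \<partial>M) = ennreal (LINT \<omega>|M. (?S \<omega> - ?R \<omega>)\<^sup>2)"
    using hS unfolding sq[symmetric] by (intro nn_integral_eq_integral) (auto simp: has_bochner_integral_iff)
  also have "(LINT \<omega>|M. (?S \<omega> - ?R \<omega>)\<^sup>2) = (LINT s|lborel. (?f s - ?g s)\<^sup>2)"
    using hS hf unfolding sq[symmetric] by (simp add: has_bochner_integral_iff)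
  also have "ennreal \<dots> = (\<integral>\<^sup>+s. ennreal ((?f s - ?g s)\<^sup>2) \<partial>lborel)"
    using hf unfolding sq[symmetric] by (intro nn_integral_eq_integral[symmetric]) (auto simp: has_bochner_integral_iff)
  also have "\<dots> = (\<integral>\<^sup>+s\<in>{0..t}. ennreal ((?f s - ?g s)\<^sup>2) \<partial>lborel)"
    by (intro nn_integral_cong)
       (auto simp: indicator_def step_function_eq_0[OF p] step_function_eq_0[OF q])
  finally show ?thesis .
qed

text \<open>The factor 2 stands in for Minkowski's inequality: it suffices for limits and avoids
  square roots of possibly infinite integrals.\<close>

lemma nn_integral_square_triangle:
  fixes f g h :: "'a \<Rightarrow> real"
  assumes [measurable]: "f \<in> borel_measurable M" "g \<in> borel_measurable M" "h \<in> borel_measurable M"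
  shows "(\<integral>\<^sup>+x. ennreal ((f x - h x)\<^sup>2) \<partial>M)
    \<le> 2 * (\<integral>\<^sup>+x. ennreal ((f x - g x)\<^sup>2) \<partial>M) + 2 * (\<integral>\<^sup>+x. ennreal ((g x - h x)\<^sup>2) \<partial>M)"
proof -
  \<comment> \<open>The gap between the two sides is the square of
    \<open>(a - b) - (b - c)\<close>.\<close>
  have "(a - c)\<^sup>2 \<le> 2 * (a - b)\<^sup>2 + 2 * (b - c)\<^sup>2" for a b c :: real
    using zero_le_power2[of "(a - b) - (b - c)"] by (simp add: power2_eq_square algebra_simps)
  then have "ennreal ((a - c)\<^sup>2) \<le> 2 * ennreal ((a - b)\<^sup>2) + 2 * ennreal ((b - c)\<^sup>2)" for a b c :: real
    by (rule order_trans[OF ennreal_leI]) (auto simp: ennreal_mult')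
  then have "(\<integral>\<^sup>+x. ennreal ((f x - h x)\<^sup>2) \<partial>M)
      \<le> (\<integral>\<^sup>+x. 2 * ennreal ((f x - g x)\<^sup>2) + 2 * ennreal ((g x - h x)\<^sup>2) \<partial>M)"
    by (intro nn_integral_mono)
  also have "\<dots> = 2 * (\<integral>\<^sup>+x. ennreal ((f x - g x)\<^sup>2) \<partial>M) + 2 * (\<integral>\<^sup>+x. ennreal ((g x - h x)\<^sup>2) \<partial>M)"
    by (simp add: nn_integral_add nn_integral_cmult)
  finally show ?thesis .
qed

lemma nn_set_integral_square_triangle:
  fixes f g h :: "real \<Rightarrow> real"
  assumes "set_borel_measurable lborel A f" "set_borel_measurable lborel A g"
    "set_borel_measurable lborel A h"
  shows "(\<integral>\<^sup>+x\<in>A. ennreal ((f x - h x)\<^sup>2) \<partial>lborel)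
    \<le> 2 * (\<integral>\<^sup>+x\<in>A. ennreal ((f x - g x)\<^sup>2) \<partial>lborel) + 2 * (\<integral>\<^sup>+x\<in>A. ennreal ((g x - h x)\<^sup>2) \<partial>lborel)"
proof -
  \<comment> \<open>The functions are measurable only on \<open>A\<close>; cutting them off there
    does not change the set integrals.\<close>
  have "(\<lambda>x. ennreal ((u x - v x)\<^sup>2) * indicator A x)
    = (\<lambda>x. ennreal ((indicator A x *\<^sub>R u x - indicator A x *\<^sub>R v x)\<^sup>2))" for u v :: "real \<Rightarrow> real"
    by (auto simp: indicator_def)
  then show ?thesis
    using nn_integral_square_triangle[OF assms[unfolded set_borel_measurable_def]] by simp
qed

lemma set_borel_measurable_step_function:
  "set_borel_measurable lborel {0..t::real} (step_function n p c)"
  unfolding set_borel_measurable_def by simp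

lemma LIMSEQ_le_zero_ennreal:
  fixes f g :: "nat \<Rightarrow> ennreal"
  assumes "g \<longlonglongrightarrow> 0" "\<And>k. f k \<le> g k"
  shows "f \<longlonglongrightarrow> 0"
  by (rule tendsto_sandwich[OF always_eventually always_eventually tendsto_const assms(1)]) (use assms(2) in auto)

text \<open>The two approximating sequences are unrelated. The chain \<open>Y\<close>,
  \<open>?S k\<close>, \<open>?S' k\<close>, \<open>Y'\<close> links them, and the isometry turns
  the middle distance into one between two step functions that are both close to
  \<open>f\<close>.\<close>

lemma has_wiener_integral_unique:
  assumes W: "standard_wiener_process M B"
    and Y: "has_wiener_integral M B f t Y" and Y': "has_wiener_integral M B f t Y'"
  shows "AE \<omega> in M. Y \<omega> = Y' \<omega>"
proof -
  obtain n p c where np: "\<And>k. is_partition t (n k) (p k)"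
    and f: "(\<lambda>k. \<integral>\<^sup>+s\<in>{0..t}. ennreal ((f s - step_function (n k) (p k) (c k) s)\<^sup>2) \<partial>lborel) \<longlonglongrightarrow> 0"
    and S: "(\<lambda>k. \<integral>\<^sup>+\<omega>. ennreal ((Y \<omega> - step_integral B (n k) (p k) (c k) \<omega>)\<^sup>2) \<partial>M) \<longlonglongrightarrow> 0"
    using Y unfolding has_wiener_integral_def by blast
  obtain m q d where mq: "\<And>k. is_partition t (m k) (q k)"
    and f': "(\<lambda>k. \<integral>\<^sup>+s\<in>{0..t}. ennreal ((f s - step_function (m k) (q k) (d k) s)\<^sup>2) \<partial>lborel) \<longlonglongrightarrow> 0"
    and S': "(\<lambda>k. \<integral>\<^sup>+\<omega>. ennreal ((Y' \<omega> - step_integral B (m k) (q k) (d k) \<omega>)\<^sup>2) \<partial>M) \<longlonglongrightarrow> 0"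
    using Y' unfolding has_wiener_integral_def by blast
  have Ym[measurable]: "Y \<in> borel_measurable M" "Y' \<in> borel_measurable M"
    and fm: "set_borel_measurable lborel {0..t} f"
    using Y Y' by (auto simp: has_wiener_integral_def)
  let ?S = "\<lambda>k. step_integral B (n k) (p k) (c k)" and ?S' = "\<lambda>k. step_integral B (m k) (q k) (d k)"
  let ?f = "\<lambda>k. step_function (n k) (p k) (c k)" and ?f' = "\<lambda>k. step_function (m k) (q k) (d k)"
  have Sm: "?S k \<in> borel_measurable M" "?S' k \<in> borel_measurable M" for k
    by (rule borel_measurable_step_integral[OF W np], rule borel_measurable_step_integral[OF W mq])
  let ?I = "\<integral>\<^sup>+\<omega>. ennreal ((Y \<omega> - Y' \<omega>)\<^sup>2) \<partial>M"
  define R where "R k = 2 * (\<integral>\<^sup>+\<omega>. ennreal ((Y \<omega> - ?S k \<omega>)\<^sup>2) \<partial>M) +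
    2 * (2 * (2 * (\<integral>\<^sup>+s\<in>{0..t}. ennreal ((f s - ?f k s)\<^sup>2) \<partial>lborel) + 2 * (\<integral>\<^sup>+s\<in>{0..t}. ennreal ((f s - ?f' k s)\<^sup>2) \<partial>lborel))
      + 2 * (\<integral>\<^sup>+\<omega>. ennreal ((Y' \<omega> - ?S' k \<omega>)\<^sup>2) \<partial>M))" for k
  have "?I \<le> R k" for k
  proof -
    have "?I \<le> 2 * (\<integral>\<^sup>+\<omega>. ennreal ((Y \<omega> - ?S k \<omega>)\<^sup>2) \<partial>M) + 2 * (\<integral>\<^sup>+\<omega>. ennreal ((?S k \<omega> - Y' \<omega>)\<^sup>2) \<partial>M)"
      by (rule nn_integral_square_triangle) (auto intro: Sm)
    also have "(\<integral>\<^sup>+\<omega>. ennreal ((?S k \<omega> - Y' \<omega>)\<^sup>2) \<partial>M) \<le>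
        2 * (\<integral>\<^sup>+\<omega>. ennreal ((?S k \<omega> - ?S' k \<omega>)\<^sup>2) \<partial>M) + 2 * (\<integral>\<^sup>+\<omega>. ennreal ((?S' k \<omega> - Y' \<omega>)\<^sup>2) \<partial>M)"
      by (rule nn_integral_square_triangle) (auto intro: Sm)
    also have "(\<integral>\<^sup>+\<omega>. ennreal ((?S k \<omega> - ?S' k \<omega>)\<^sup>2) \<partial>M)
        = (\<integral>\<^sup>+s\<in>{0..t}. ennreal ((?f k s - ?f' k s)\<^sup>2) \<partial>lborel)"
      by (rule step_integral_isometry[OF W np mq])
    also have "\<dots> \<le> 2 * (\<integral>\<^sup>+s\<in>{0..t}. ennreal ((?f k s - f s)\<^sup>2) \<partial>lborel)
        + 2 * (\<integral>\<^sup>+s\<in>{0..t}. ennreal ((f s - ?f' k s)\<^sup>2) \<partial>lborel)"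
      by (rule nn_set_integral_square_triangle) (auto intro: fm set_borel_measurable_step_function)
    finally show ?thesis
      unfolding R_def by (simp add: power2_commute[of "f _"] power2_commute[of "Y' _"] mult_left_mono add_mono)
  qed
  moreover have "R \<longlonglongrightarrow> 2 * 0 + 2 * (2 * (2 * 0 + 2 * 0) + 2 * 0)"
    unfolding R_def by (intro tendsto_add ennreal_tendsto_cmult S S' f f') auto
  ultimately have "?I \<le> 0"
    by (intro LIMSEQ_le_const[of R]) auto
  then have "AE \<omega> in M. ennreal ((Y \<omega> - Y' \<omega>)\<^sup>2) = 0"
    by (subst nn_integral_0_iff_AE[symmetric]) auto
  then show ?thesis by eventually_elim (simp add: ennreal_eq_0_iff)
qed

text \<open>Mean-square convergence of the step integrals follows from pointwise convergence, by Fatou's lemma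
  and the isometry.\<close>

lemma has_wiener_integralI_AE:
  assumes W: "standard_wiener_process M B"
    and fm: "set_borel_measurable lborel {0..t} f" and Ym[measurable]: "Y \<in> borel_measurable M"
    and np: "\<And>k. is_partition t (n k) (p k)"
    and f: "(\<lambda>k. \<integral>\<^sup>+s\<in>{0..t}. ennreal ((f s - step_function (n k) (p k) (c k) s)\<^sup>2) \<partial>lborel) \<longlonglongrightarrow> 0"
    and ae: "AE \<omega> in M. (\<lambda>k. step_integral B (n k) (p k) (c k) \<omega>) \<longlonglongrightarrow> Y \<omega>"
  shows "has_wiener_integral M B f t Y"
proof -
  let ?S = "\<lambda>k. step_integral B (n k) (p k) (c k)"
  let ?f = "\<lambda>k. step_function (n k) (p k) (c k)"
  let ?e = "\<lambda>k. \<integral>\<^sup>+s\<in>{0..t}. ennreal ((f s - ?f k s)\<^sup>2) \<partial>lborel"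
  have Sm[measurable]: "?S k \<in> borel_measurable M" for k
    by (rule borel_measurable_step_integral[OF W np])
  \<comment> \<open>Here \<open>k\<close> is fixed and \<open>l\<close> tends to infinity:
    \<open>?S l\<close> tends to \<open>Y\<close> almost surely, and \<open>2 * ?e l\<close>
    disappears from the bound.\<close>
  have bound: "(\<integral>\<^sup>+\<omega>. ennreal ((Y \<omega> - ?S k \<omega>)\<^sup>2) \<partial>M) \<le> 2 * ?e k" for k
  proof -
    have "(\<integral>\<^sup>+\<omega>. ennreal ((Y \<omega> - ?S k \<omega>)\<^sup>2) \<partial>M)
        = (\<integral>\<^sup>+\<omega>. liminf (\<lambda>l. ennreal ((?S l \<omega> - ?S k \<omega>)\<^sup>2)) \<partial>M)"
    proof (rule nn_integral_cong_AE, use ae in eventually_elim)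
      case (elim \<omega>)
      then have "(\<lambda>l. ennreal ((?S l \<omega> - ?S k \<omega>)\<^sup>2)) \<longlonglongrightarrow> ennreal ((Y \<omega> - ?S k \<omega>)\<^sup>2)"
        by (intro tendsto_ennrealI tendsto_intros)
      then show ?case by (rule lim_imp_Liminf[OF trivial_limit_sequentially, symmetric])
    qed
    also have "\<dots> \<le> liminf (\<lambda>l. \<integral>\<^sup>+\<omega>. ennreal ((?S l \<omega> - ?S k \<omega>)\<^sup>2) \<partial>M)"
      by (rule nn_integral_liminf) simp
    also have "\<dots> \<le> liminf (\<lambda>l. 2 * ?e l + 2 * ?e k)"
    proof (rule Liminf_mono, rule always_eventually, rule allI)
      fix l
      have "(\<integral>\<^sup>+\<omega>. ennreal ((?S l \<omega> - ?S k \<omega>)\<^sup>2) \<partial>M) = (\<integral>\<^sup>+s\<in>{0..t}. ennreal ((?f l s - ?f k s)\<^sup>2) \<partial>lborel)"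
        by (rule step_integral_isometry[OF W np np])
      also have "\<dots> \<le> 2 * (\<integral>\<^sup>+s\<in>{0..t}. ennreal ((?f l s - f s)\<^sup>2) \<partial>lborel)
          + 2 * (\<integral>\<^sup>+s\<in>{0..t}. ennreal ((f s - ?f k s)\<^sup>2) \<partial>lborel)"
        by (rule nn_set_integral_square_triangle) (auto intro: fm set_borel_measurable_step_function)
      finally show "(\<integral>\<^sup>+\<omega>. ennreal ((?S l \<omega> - ?S k \<omega>)\<^sup>2) \<partial>M) \<le> 2 * ?e l + 2 * ?e k"
        by (simp add: power2_commute[of "f _"])
    qed
    also have "\<dots> = 2 * 0 + 2 * ?e k"
      by (intro lim_imp_Liminf tendsto_add ennreal_tendsto_cmult f tendsto_const) auto
    finally show ?thesis by simp
  qed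
  have "(\<lambda>k. 2 * ?e k) \<longlonglongrightarrow> 2 * 0" by (intro ennreal_tendsto_cmult f) auto
  then have "(\<lambda>k. \<integral>\<^sup>+\<omega>. ennreal ((Y \<omega> - ?S k \<omega>)\<^sup>2) \<partial>M) \<longlonglongrightarrow> 0"
    using bound by - (rule LIMSEQ_le_zero_ennreal[of "\<lambda>k. 2 * ?e k"], simp_all)
  then show ?thesis
    unfolding has_wiener_integral_def using fm Ym np f by blast
qed

section \<open>Mean-square limits\<close>

text \<open>The Gaussian Hilbert space of \<open>B\<close>: the L2-closure of the linear span of its
  values. It is a linear space of centered Gaussian variables, so joint Gaussianity follows without
  computing any covariance.\<close>

definition wiener_limit :: "'a measure \<Rightarrow> (real \<Rightarrow> 'a \<Rightarrow> real) \<Rightarrow> ('a \<Rightarrow> real) \<Rightarrow> bool" where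
  "wiener_limit M B Y \<longleftrightarrow> Y \<in> borel_measurable M \<and>
     (\<exists>Z. (\<forall>k. wiener_combination B (Z k)) \<and>
        (\<lambda>k::nat. \<integral>\<^sup>+\<omega>. ennreal ((Y \<omega> - Z k \<omega>)\<^sup>2) \<partial>M) \<longlonglongrightarrow> 0)"

lemma has_wiener_integral_imp_wiener_limit:
  assumes "has_wiener_integral M B f t Y"
  shows "wiener_limit M B Y"
proof -
  obtain n p c where "\<And>k. is_partition t (n k) (p k)"
    and "(\<lambda>k. \<integral>\<^sup>+\<omega>. ennreal ((Y \<omega> - step_integral B (n k) (p k) (c k) \<omega>)\<^sup>2) \<partial>M) \<longlonglongrightarrow> 0"
    using assms unfolding has_wiener_integral_def by blast
  moreover have "Y \<in> borel_measurable M" using assms by (simp add: has_wiener_integral_def)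
  ultimately show ?thesis
    unfolding wiener_limit_def
    by (intro conjI exI[of _ "\<lambda>k. step_integral B (n k) (p k) (c k)"])
       (auto intro: wiener_combination_step_integral)
qed

lemma wiener_limit_zero: "wiener_limit M B (\<lambda>_. 0)"
  unfolding wiener_limit_def by (auto intro!: exI[of _ "\<lambda>_ _. 0"] wiener_combination_zero)

lemma wiener_limit_linear:
  assumes W: "standard_wiener_process M B" and "wiener_limit M B Y" "wiener_limit M B Y'"
  shows "wiener_limit M B (\<lambda>\<omega>. a * Y \<omega> + Y' \<omega>)"
proof -
  obtain Z where Z: "\<And>k. wiener_combination B (Z k)"
    and lim: "(\<lambda>k::nat. \<integral>\<^sup>+\<omega>. ennreal ((Y \<omega> - Z k \<omega>)\<^sup>2) \<partial>M) \<longlonglongrightarrow> 0"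
    using assms unfolding wiener_limit_def by blast
  obtain Z' where Z': "\<And>k. wiener_combination B (Z' k)"
    and lim': "(\<lambda>k::nat. \<integral>\<^sup>+\<omega>. ennreal ((Y' \<omega> - Z' k \<omega>)\<^sup>2) \<partial>M) \<longlonglongrightarrow> 0"
    using assms unfolding wiener_limit_def by blast
  have [measurable]: "Y \<in> borel_measurable M" "Y' \<in> borel_measurable M"
    using assms unfolding wiener_limit_def by blast+
  have [measurable]: "Z k \<in> borel_measurable M" "Z' k \<in> borel_measurable M" for k
    using wiener_combination_gaussian[OF W Z[of k]] wiener_combination_gaussian[OF W Z'[of k]]
    by (auto simp: gaussian_char_def)
  let ?V = "\<lambda>\<omega>. a * Y \<omega> + Y' \<omega>" and ?V' = "\<lambda>k \<omega>. a * Z k \<omega> + Z' k \<omega>"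
  let ?R = "\<lambda>k. 2 * (ennreal (a\<^sup>2) * (\<integral>\<^sup>+\<omega>. ennreal ((Y \<omega> - Z k \<omega>)\<^sup>2) \<partial>M))
    + 2 * (\<integral>\<^sup>+\<omega>. ennreal ((Y' \<omega> - Z' k \<omega>)\<^sup>2) \<partial>M)"
  have "(\<integral>\<^sup>+\<omega>. ennreal ((?V \<omega> - ?V' k \<omega>)\<^sup>2) \<partial>M) \<le> ?R k" for k
  proof -
    have "(\<integral>\<^sup>+\<omega>. ennreal ((?V \<omega> - ?V' k \<omega>)\<^sup>2) \<partial>M)
      \<le> 2 * (\<integral>\<^sup>+\<omega>. ennreal ((?V \<omega> - (a * Z k \<omega> + Y' \<omega>))\<^sup>2) \<partial>M)
        + 2 * (\<integral>\<^sup>+\<omega>. ennreal (((a * Z k \<omega> + Y' \<omega>) - ?V' k \<omega>)\<^sup>2) \<partial>M)"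
      by (rule nn_integral_square_triangle) simp_all
    also have "(\<integral>\<^sup>+\<omega>. ennreal ((?V \<omega> - (a * Z k \<omega> + Y' \<omega>))\<^sup>2) \<partial>M)
        = (\<integral>\<^sup>+\<omega>. ennreal (a\<^sup>2) * ennreal ((Y \<omega> - Z k \<omega>)\<^sup>2) \<partial>M)"
      by (intro nn_integral_cong) (simp flip: ennreal_mult' power_mult_distrib right_diff_distrib)
    also have "\<dots> = ennreal (a\<^sup>2) * (\<integral>\<^sup>+\<omega>. ennreal ((Y \<omega> - Z k \<omega>)\<^sup>2) \<partial>M)"
      by (rule nn_integral_cmult) simp
    finally show ?thesis by simp
  qed
  moreover have "?R \<longlonglongrightarrow> 2 * (ennreal (a\<^sup>2) * 0) + 2 * 0"
    by (intro tendsto_add ennreal_tendsto_cmult lim lim') auto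
  ultimately have "(\<lambda>k. \<integral>\<^sup>+\<omega>. ennreal ((?V \<omega> - ?V' k \<omega>)\<^sup>2) \<partial>M) \<longlonglongrightarrow> 0"
    by - (rule LIMSEQ_le_zero_ennreal[of ?R], simp_all)
  then show ?thesis
    unfolding wiener_limit_def
    by (intro conjI exI[of _ ?V'] allI wiener_combination_add wiener_combination_scale Z Z') simp_all
qed

lemma wiener_limit_sum:
  assumes "standard_wiener_process M B" "finite J" "\<And>t. t \<in> J \<Longrightarrow> wiener_limit M B (Y t)"
  shows "wiener_limit M B (\<lambda>\<omega>. \<Sum>t\<in>J. c t * Y t \<omega>)"
  using assms(2,3)
  by (induction J rule: finite_induct) (auto intro: wiener_limit_zero wiener_limit_linear[OF assms(1)])

lemma wiener_limit_gaussian: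
  assumes W: "standard_wiener_process M B" and Y: "wiener_limit M B Y"
  shows "gaussian_rv M Y" "integrable M Y" "integral\<^sup>L M Y = 0"
proof -
  interpret prob_space M using W by (simp add: standard_wiener_process_def)
  obtain Z where "\<And>k. wiener_combination B (Z k)" "Y \<in> borel_measurable M"
    and "(\<lambda>k::nat. \<integral>\<^sup>+\<omega>. ennreal ((Y \<omega> - Z k \<omega>)\<^sup>2) \<partial>M) \<longlonglongrightarrow> 0"
    using Y unfolding wiener_limit_def by blast
  then obtain v where "gaussian_char M Y v"
    using gaussian_char_limit[of Z Y] wiener_combination_gaussian[OF W] by blast
  then show "gaussian_rv M Y" "integrable M Y" "integral\<^sup>L M Y = 0"
    by (rule gaussian_char_imp_gaussian)+
qed

section \<open>Riemann--Stieltjes sums\<close>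

text \<open>The cells are open on the left, so \<open>s\<close> lies in cell \<open>j\<close>
  exactly if \<open>j + 1\<close> is the ceiling of \<open>s * N / t\<close>. The point 0 lies in no
  cell.\<close>

lemma step_function_uniform:
  assumes t: "0 < t" and N: "0 < N" and s: "s \<in> {0<..t}"
  shows "\<exists>j<N. s \<in> {t * real j / real N<..t * real (Suc j) / real N}
    \<and> step_function N (\<lambda>i. t * real i / real N) c s = c j"
proof -
  define j where "j = nat (\<lceil>s * N / t\<rceil> - 1)"
  have "0 < s * N / t" "s * N / t \<le> N" using t N s by (auto simp: field_simps)
  then have c1: "1 \<le> \<lceil>s * N / t\<rceil>" "\<lceil>s * N / t\<rceil> \<le> int N"
    by (auto simp: ceiling_le_iff)
  then have j: "int j = \<lceil>s * N / t\<rceil> - 1" "j < N" using N by (auto simp: j_def)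
  have iff: "s \<in> {t * real i / N<..t * real (Suc i) / N} \<longleftrightarrow> i = j" for i
  proof -
    have "s \<in> {t * real i / N<..t * real (Suc i) / N} \<longleftrightarrow> real i < s * N / t \<and> s * N / t \<le> real i + 1"
      using t N by (auto simp: field_simps)
    also have "\<dots> \<longleftrightarrow> \<lceil>s * N / t\<rceil> = int i + 1"
      by (auto simp: ceiling_eq_iff)
    also have "\<dots> \<longleftrightarrow> i = j" using j by auto
    finally show ?thesis .
  qed
  have "step_function N (\<lambda>i. t * real i / real N) c s = (\<Sum>i<N. if i = j then c i else 0)"
    unfolding step_function_def by (intro sum.cong refl) (simp add: indicator_def iff del: greaterThanAtMost_iff of_nat_Suc)
  also have "\<dots> = c j" using j by simp
  finally show ?thesis using j iff[of j] by blast
qed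

lemma is_partition_uniform: "0 \<le> t \<Longrightarrow> is_partition t (Suc k) (\<lambda>i. t * real i / real (Suc k))"
  by (auto simp: is_partition_def divide_right_mono mult_left_mono simp del: of_nat_Suc)

text \<open>For \<open>s > 0\<close> the step function takes the value of \<open>f\<close> at a grid
  point within one mesh of \<open>s\<close>. Continuity then gives pointwise convergence, and
  boundedness on the compact interval gives a dominating constant.\<close>

lemma step_function_uniform_L2:
  fixes f :: "real \<Rightarrow> real"
  assumes t: "0 \<le> t" and f: "continuous_on {0..t} f"
  shows "(\<lambda>k. \<integral>\<^sup>+s\<in>{0..t}. ennreal ((f s - step_function (Suc k) (\<lambda>i. t * real i / real (Suc k))
    (\<lambda>i. f (t * real i / real (Suc k))) s)\<^sup>2) \<partial>lborel) \<longlonglongrightarrow> 0"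
proof -
  define g where "g k = step_function (Suc k) (\<lambda>i. t * real i / real (Suc k))
    (\<lambda>i. f (t * real i / real (Suc k)))" for k
  have gm[measurable]: "g k \<in> borel_measurable borel" for k
    unfolding g_def step_function_def by measurable
  have fm: "(\<lambda>s. indicator {0..t} s *\<^sub>R f s) \<in> borel_measurable lborel"
    using borel_measurable_continuous_on_indicator[OF _ f] by simp
  have g: "\<exists>x\<in>{0..t}. \<bar>x - s\<bar> \<le> t / real (Suc k) \<and> g k s = f x" if s: "s \<in> {0<..t}" for k s
  proof -
    obtain j where j: "j < Suc k" "s \<in> {t * real j / real (Suc k)<..t * real (Suc j) / real (Suc k)}"
      "g k s = f (t * real j / real (Suc k))"
      using step_function_uniform[of t "Suc k" s "\<lambda>i. f (t * real i / real (Suc k))"] s t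
      unfolding g_def by auto
    have "t * real j / real (Suc k) \<le> t" 
      using j(1) t mult_left_mono[of "real j" "real (Suc k)" t] by (simp add: field_simps)
    moreover have "t * real (Suc j) / real (Suc k) = t * real j / real (Suc k) + t / real (Suc k)"
      by (simp add: distrib_left add_divide_distrib add.commute)
    ultimately show ?thesis
      using j t by (intro bexI[of _ "t * real j / real (Suc k)"]) (auto simp del: of_nat_Suc)
  qed
  obtain C where "\<forall>x\<in>{0..t}. \<bar>f x\<bar> \<le> C"
    using compact_imp_bounded[OF compact_continuous_image[OF f compact_Icc]]
    unfolding bounded_iff by auto
  note C = bspec[OF this]
  \<comment> \<open>At 0, which no cell contains, the step function vanishes whatever
    \<open>f 0\<close> is; this single point is discarded.\<close>
  have ae: "AE s in lborel. s \<noteq> (0::real)" by (rule AE_lborel_singleton)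
  have "(\<lambda>k. \<integral>\<^sup>+s. ennreal ((indicator {0..t} s *\<^sub>R f s - indicator {0..t} s *\<^sub>R g k s)\<^sup>2) \<partial>lborel)
      \<longlonglongrightarrow> (\<integral>\<^sup>+s. 0 \<partial>(lborel :: real measure))"
  proof (rule nn_integral_dominated_convergence[where w = "\<lambda>s. ennreal ((2 * C)\<^sup>2) * indicator {0..t} s"])
    show "(\<integral>\<^sup>+s. ennreal ((2 * C)\<^sup>2) * indicator {0..t} s \<partial>lborel) < \<infinity>"
      using t by (simp add: nn_integral_cmult ennreal_mult_less_top)
    show "AE s in lborel. ennreal ((indicator {0..t} s *\<^sub>R f s - indicator {0..t} s *\<^sub>R g k s)\<^sup>2)
        \<le> ennreal ((2 * C)\<^sup>2) * indicator {0..t} s" for k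
      using ae
    proof eventually_elim
      case (elim s)
      show ?case
      proof (cases "s \<in> {0..t}")
        case True
        then obtain x where "x \<in> {0..t}" "g k s = f x" using g[of s k] elim by auto
        then have "\<bar>f s - g k s\<bar> \<le> \<bar>2 * C\<bar>" using C[of s] C[of x] True by simp
        then show ?thesis using True by (simp add: abs_le_square_iff ennreal_leI)
      qed simp
    qed
    show "AE s in lborel. (\<lambda>k. ennreal ((indicator {0..t} s *\<^sub>R f s - indicator {0..t} s *\<^sub>R g k s)\<^sup>2)) \<longlonglongrightarrow> 0"
      using ae
    proof eventually_elim
      case (elim s)
      show ?case
      proof (cases "s \<in> {0..t}")
        case True
        then have "\<forall>k. \<exists>x\<in>{0..t}. \<bar>x - s\<bar> \<le> t / real (Suc k) \<and> g k s = f x"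
          using g[of s] elim by auto
        then obtain x where x: "\<And>k. x k \<in> {0..t}" "\<And>k. \<bar>x k - s\<bar> \<le> t / real (Suc k)" "\<And>k. g k s = f (x k)"
          by metis
        have "(\<lambda>k. t / real (Suc k)) \<longlonglongrightarrow> 0"
          using LIMSEQ_Suc[OF lim_const_over_n[of t]] by simp
        then have "(\<lambda>k. x k - s) \<longlonglongrightarrow> 0"
          by (rule Lim_null_comparison[rotated]) (use x(2) in simp)
        then have "x \<longlonglongrightarrow> s" by (simp add: LIM_zero_iff)
        then have "(\<lambda>k. f (x k)) \<longlonglongrightarrow> f s"
          using continuous_on_tendsto_compose[OF f, of x s sequentially] x(1) True by simp
        then have "(\<lambda>k. ennreal ((f s - g k s)\<^sup>2)) \<longlonglongrightarrow> ennreal ((f s - f s)\<^sup>2)"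
          unfolding x(3) by (intro tendsto_ennrealI tendsto_intros)
        then show ?thesis using True by simp
      qed simp
    qed
  qed (use fm in measurable)
  moreover have "(\<lambda>s. ennreal ((f s - g k s)\<^sup>2) * indicator {0..t} s)
    = (\<lambda>s. ennreal ((indicator {0..t} s *\<^sub>R f s - indicator {0..t} s *\<^sub>R g k s)\<^sup>2))" for k
    by (auto simp: indicator_def)
  ultimately show ?thesis by (simp add: g_def)
qed

text \<open>Summation by parts leaves \<open>\<Sum>\<^sub>i b p\<^sub>i\<^sub>+\<^sub>1 (f p\<^sub>i\<^sub>+\<^sub>1 - f p\<^sub>i)\<close>, which is compared with the integral of \<open>b f'\<close>
  on each subinterval by the mean value inequality.\<close>

lemma riemann_stieltjes_sum_limit:
  fixes b f f' :: "real \<Rightarrow> real"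
  assumes t: "0 \<le> t" and b: "continuous_on {0..t} b" and f'c: "continuous_on {0..t} f'"
    and f: "\<And>s. s \<in> {0..t} \<Longrightarrow> (f has_real_derivative f' s) (at s within {0..t})"
  shows "(\<lambda>k. \<Sum>i<Suc k. f (t * real i / real (Suc k)) *
      (b (t * real (Suc i) / real (Suc k)) - b (t * real i / real (Suc k))))
    \<longlonglongrightarrow> f t * b t - f 0 * b 0 - integral {0..t} (\<lambda>s. b s * f' s)" (is "?S \<longlonglongrightarrow> ?L")
proof -
  define G where "G x = integral {0..x} (\<lambda>s. b s * f' s)" for x
  have G: "(G has_real_derivative b s * f' s) (at s within {0..t})" if "s \<in> {0..t}" for s
    unfolding G_def by (rule integral_has_real_derivative) (use b f'c that in \<open>auto intro: continuous_intros\<close>)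
  obtain C where C: "0 < C" "\<And>x. x \<in> {0..t} \<Longrightarrow> \<bar>f' x\<bar> \<le> C"
    using compact_imp_bounded[OF compact_continuous_image[OF f'c compact_Icc]]
    unfolding bounded_pos by auto
  have "uniformly_continuous_on {0..t} b" by (rule compact_uniformly_continuous[OF b compact_Icc])
  then have uc: "\<exists>d>0. \<forall>x\<in>{0..t}. \<forall>y\<in>{0..t}. \<bar>y - x\<bar> < d \<longrightarrow> \<bar>b y - b x\<bar> < e" if "0 < e" for e
    using that by (simp add: uniformly_continuous_on_def dist_real_def)
  show ?thesis
  proof (rule LIMSEQ_I)
    fix r :: real assume r: "0 < r"
    \<comment> \<open>The errors of all cells add up to at most \<open>e * (C * t)\<close>; the
      \<open>+ 1\<close> makes the final bound strict and covers \<open>t = 0\<close>.\<close>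
    define e where "e = r / (C * t + 1)"
    have den: "0 < C * t + 1" using C(1) t by (simp add: add_nonneg_pos)
    have e: "0 < e" using r den by (simp add: e_def)
    obtain d where d: "d > 0" "\<And>x y. x \<in> {0..t} \<Longrightarrow> y \<in> {0..t} \<Longrightarrow> \<bar>y - x\<bar> < d \<Longrightarrow> \<bar>b y - b x\<bar> < e"
      using uc[OF e] by blast
    have "(\<lambda>k. t / real (Suc k)) \<longlonglongrightarrow> 0"
      using LIMSEQ_Suc[OF lim_const_over_n[of t]] by simp
    then have "eventually (\<lambda>k. t / real (Suc k) < d) sequentially"
      using d(1) by (rule order_tendstoD(2))
    then obtain K where K: "\<And>k. k \<ge> K \<Longrightarrow> t / real (Suc k) < d"
      unfolding eventually_sequentially by blast
    have "norm (?S k - ?L) < r" if k: "k \<ge> K" for k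
    proof -
      define p where "p i = t * real i / real (Suc k)" for i
      have p0: "p 0 = 0" and pN: "p (Suc k) = t" by (auto simp: p_def)
      have pstep: "p (Suc i) - p i = t / real (Suc k)" for i
        unfolding p_def diff_divide_distrib[symmetric] right_diff_distrib[symmetric] by simp
      have ple: "p i \<le> p (Suc i)" for i using pstep[of i] t by (smt (verit) divide_nonneg_nonneg of_nat_0_le_iff)
      have pin: "p i \<in> {0..t}" if "i \<le> Suc k" for i
        using that t mult_left_mono[of "real i" "real (Suc k)" t] by (auto simp: p_def field_simps)
      have tele: "(\<Sum>i<Suc k. h (p (Suc i)) - h (p i)) = h t - h 0" for h :: "real \<Rightarrow> real"
        using sum_lessThan_telescope[of "\<lambda>i. h (p i)" "Suc k"] by (simp only: p0 pN)
      have "?S k = (\<Sum>i<Suc k. (f (p (Suc i)) * b (p (Suc i)) - f (p i) * b (p i))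
          - b (p (Suc i)) * (f (p (Suc i)) - f (p i)))"
        unfolding p_def[symmetric] by (intro sum.cong refl) (simp add: algebra_simps)
      also have "\<dots> = f t * b t - f 0 * b 0 - (\<Sum>i<Suc k. b (p (Suc i)) * (f (p (Suc i)) - f (p i)))"
        unfolding sum_subtractf[of _ _ "{..<Suc k}"] using tele[of "\<lambda>x. f x * b x"] by (simp only: sum_subtractf)
      finally have "?S k - ?L = (G t - G 0) - (\<Sum>i<Suc k. b (p (Suc i)) * (f (p (Suc i)) - f (p i)))"
        by (simp add: G_def)
      \<comment> \<open>The integral is telescoped over the same cells, so that both terms are
        compared cell by cell.\<close>
      also have "G t - G 0 = (\<Sum>i<Suc k. G (p (Suc i)) - G (p i))" by (rule tele[symmetric])
      also have "\<dots> - (\<Sum>i<Suc k. b (p (Suc i)) * (f (p (Suc i)) - f (p i)))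
          = (\<Sum>i<Suc k. (G (p (Suc i)) - b (p (Suc i)) * f (p (Suc i))) - (G (p i) - b (p (Suc i)) * f (p i)))"
        unfolding sum_subtractf[symmetric] by (intro sum.cong refl) (simp add: algebra_simps)
      finally have eq: "?S k - ?L = \<dots>" .
      have "\<bar>(G (p (Suc i)) - b (p (Suc i)) * f (p (Suc i))) - (G (p i) - b (p (Suc i)) * f (p i))\<bar>
          \<le> e * C * (t / real (Suc k))" if i: "i < Suc k" for i
      proof -
        \<comment> \<open>With \<open>b\<close> frozen at the right endpoint, the derivative of
          \<open>?H\<close> is \<open>(b s - b (p (Suc i))) * f' s\<close>, small by uniform
          continuity of \<open>b\<close>.\<close>
        let ?H = "\<lambda>s. G s - b (p (Suc i)) * f s"
        have sub: "{p i..p (Suc i)} \<subseteq> {0..t}" using pin[of i] pin[of "Suc i"] i by auto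
        have "norm (?H (p (Suc i)) - ?H (p i)) \<le> (e * C) * norm (p (Suc i) - p i)"
        proof (rule field_differentiable_bound[where S = "{p i..p (Suc i)}" and f' = "\<lambda>s. b s * f' s - b (p (Suc i)) * f' s"])
          fix s assume s: "s \<in> {p i..p (Suc i)}"
          then have st: "s \<in> {0..t}" using sub by auto
          show "(?H has_field_derivative b s * f' s - b (p (Suc i)) * f' s) (at s within {p i..p (Suc i)})"
            by (rule DERIV_subset[OF _ sub]) (intro DERIV_diff DERIV_cmult G f st)
          have "\<bar>b s - b (p (Suc i))\<bar> < e"
            using s pstep[of i] K[OF k] pin[of "Suc i"] i st by (intro d(2)) (auto simp del: of_nat_Suc)
          then have "\<bar>b s - b (p (Suc i))\<bar> * \<bar>f' s\<bar> \<le> e * C"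
            using C(2)[OF st] e by (intro mult_mono) auto
          then show "norm (b s * f' s - b (p (Suc i)) * f' s) \<le> e * C"
            by (simp add: abs_mult[symmetric] left_diff_distrib)
        qed (use ple in auto)
        then show ?thesis using t by (simp add: pstep del: of_nat_Suc)
      qed
      then have "norm (?S k - ?L) \<le> (\<Sum>i<Suc k. e * C * (t / real (Suc k)))"
        unfolding eq real_norm_def by (intro order_trans[OF sum_abs] sum_mono) auto
      also have "\<dots> = e * (C * t)" by (simp del: of_nat_Suc sum.lessThan_Suc)
      also have "\<dots> < e * (C * t + 1)" using e by simp
      also have "\<dots> = r" using den by (simp add: e_def)
      finally show ?thesis .
    qed
    then show "\<exists>K. \<forall>k\<ge>K. norm (?S k - ?L) < r" by blast
  qed
qed

text \<open>The quotient of the derivatives is \<open>b t\<close> itself wherever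
  \<open>f' t \<noteq> 0\<close>. The rule for a denominator tending to infinity is the right one,
  since the numerator may stay bounded or oscillate.\<close>

lemma weighted_average_tendsto:
  fixes b f f' :: "real \<Rightarrow> real"
  assumes T: "0 < T" and b: "continuous_on {0..T} b" and f'c: "continuous_on {0..<T} f'"
    and f: "\<And>s. s \<in> {0<..<T} \<Longrightarrow> (f has_real_derivative f' s) (at s)"
    and top: "filterlim f at_top (at_left T)"
    and f'0: "eventually (\<lambda>s. f' s \<noteq> 0) (at_left T)"
  shows "((\<lambda>t. integral {0..t} (\<lambda>s. b s * f' s) / f t) \<longlongrightarrow> b T) (at_left T)"
proof (rule lhopital_left_at_top[OF top f'0])
  have ev: "eventually (\<lambda>s. s \<in> {0<..<T}) (at_left T)"
    using eventually_at_left_real[OF T] .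
  then show "eventually (\<lambda>s. (f has_real_derivative f' s) (at s)) (at_left T)"
    by eventually_elim (rule f)
  show "eventually (\<lambda>t. ((\<lambda>t. integral {0..t} (\<lambda>s. b s * f' s)) has_real_derivative b t * f' t) (at t)) (at_left T)"
    using ev
  proof eventually_elim
    case (elim t)
    \<comment> \<open>The integrand is continuous only on \<open>[0,T)\<close>, so the fundamental
      theorem of calculus is applied on a compact interval with \<open>t\<close> in its
      interior.\<close>
    define u where "u = (t + T) / 2"
    have u: "0 < t" "t < u" "u < T" using elim by (auto simp: u_def)
    have "continuous_on {0..u} (\<lambda>s. b s * f' s)"
      using u by (intro continuous_intros continuous_on_subset[OF b] continuous_on_subset[OF f'c]) auto
    then have "((\<lambda>t. integral {0..t} (\<lambda>s. b s * f' s)) has_real_derivative b t * f' t) (at t within {0..u})"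
      by (rule integral_has_real_derivative) (use u in auto)
    then show ?case using u by (simp add: at_within_Icc_at)
  qed
  have "(b \<longlongrightarrow> b T) (at_left T)"
    using b T by (auto simp: continuous_on_def at_within_Icc_at_left dest!: bspec[of _ _ T])
  then show "((\<lambda>t. b t * f' t / f' t) \<longlongrightarrow> b T) (at_left T)"
    by (rule Lim_transform_eventually) (use f'0 in eventually_elim, simp)
qed

section \<open>The bridge\<close>

lemma at_within_atLeastLessThan:
  fixes x u T :: real
  assumes "x < u" "u < T"
  shows "at x within {0..<T} = at x within {0..u}"
  by (rule at_within_nhd[of _ "{..<u}"]) (use assms in auto)

lemma integral_has_derivative_atLeastLessThan:
  fixes h :: "real \<Rightarrow> real"
  assumes h: "continuous_on {0..<T} h" and x: "x \<in> {0..<T}"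
  shows "((\<lambda>t. integral {0..t} h) has_real_derivative h x) (at x within {0..<T})"
proof -
  define u where "u = (x + T) / 2"
  have u: "x < u" "u < T" using x by (auto simp: u_def)
  have "((\<lambda>t. integral {0..t} h) has_real_derivative h x) (at x within {0..u})"
    by (rule integral_has_real_derivative[OF continuous_on_subset[OF h]]) (use x u in auto)
  then show ?thesis using u by (simp add: at_within_atLeastLessThan)
qed

text \<open>Pathwise integration by parts against the continuously differentiable \<open>f\<close> gives the continuous
  version of the Wiener integral.\<close>

lemma continuous_wiener_integral_by_parts:
  assumes W: "standard_wiener_process M B" and f'c: "continuous_on {0..<T} f'"
    and f: "\<And>s. s \<in> {0..<T} \<Longrightarrow> (f has_real_derivative f' s) (at s within {0..<T})"
  obtains I where "is_continuous_wiener_integral M B T f I"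
    "AE \<omega> in M. \<forall>t\<in>{0..<T}. I t \<omega> = f t * B t \<omega> - integral {0..t} (\<lambda>s. B s \<omega> * f' s)"
proof -
  have "AE \<omega> in M. B 0 \<omega> = 0 \<and> continuous_on {0..} (\<lambda>t. B t \<omega>)"
    using W by (simp add: standard_wiener_process_def)
  then obtain N where good: "\<And>\<omega>. \<omega> \<in> space M - N \<Longrightarrow> B 0 \<omega> = 0 \<and> continuous_on {0..} (\<lambda>t. B t \<omega>)"
    and N: "N \<in> null_sets M" by (rule AE_E3) blast
  have Nm[measurable]: "N \<in> sets M" using N by auto
  define J where "J t \<omega> = f t * B t \<omega> - integral {0..t} (\<lambda>s. B s \<omega> * f' s)" for t \<omega>
  \<comment> \<open>The value 0 on \<open>N\<close> makes \<open>I t\<close> an everywhere limit of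
    measurable functions, the step integrals cut off on \<open>N\<close>. This yields measurability
    of the pathwise integral in \<open>\<omega>\<close>.\<close>
  define I where "I t \<omega> = (if \<omega> \<in> N then 0 else J t \<omega>)" for t \<omega>
  have aeN: "AE \<omega> in M. \<omega> \<in> space M - N"
    using AE_not_in[OF N] AE_space by eventually_elim simp
  have fc: "continuous_on {0..<T} f"
    unfolding continuous_on_eq_continuous_within by (intro ballI DERIV_continuous[OF f])
  have int: "has_wiener_integral M B f t (I t)" if t: "t \<in> {0..<T}" for t
  proof -
    define S where "S k = step_integral B (Suc k) (\<lambda>i. t * real i / real (Suc k))
      (\<lambda>i. f (t * real i / real (Suc k)))" for k
    have part: "is_partition t (Suc k) (\<lambda>i. t * real i / real (Suc k))" for k
      using t by (intro is_partition_uniform) simp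
    have Sm[measurable]: "S k \<in> borel_measurable M" for k
      unfolding S_def by (rule borel_measurable_step_integral[OF W part])
    have sub: "{0..t} \<subseteq> {0..<T}" using t by auto
    have fct: "continuous_on {0..t} f" by (rule continuous_on_subset[OF fc sub])
    have lim: "(\<lambda>k. S k \<omega>) \<longlonglongrightarrow> I t \<omega>" if w: "\<omega> \<in> space M - N" for \<omega>
    proof -
      have "(\<lambda>k. S k \<omega>) \<longlonglongrightarrow> f t * B t \<omega> - f 0 * B 0 \<omega> - integral {0..t} (\<lambda>s. B s \<omega> * f' s)"
        unfolding S_def step_integral_def
      proof (rule riemann_stieltjes_sum_limit)
        show "continuous_on {0..t} (\<lambda>t. B t \<omega>)"
          using good[OF w] by (auto intro: continuous_on_subset)
        show "(f has_real_derivative f' s) (at s within {0..t})" if "s \<in> {0..t}" for s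
          by (rule DERIV_subset[OF f sub]) (use that t in auto)
      qed (use t continuous_on_subset[OF f'c sub] in auto)
      then show ?thesis using good[OF w] w by (simp add: I_def J_def)
    qed
    show ?thesis
    proof (rule has_wiener_integralI_AE[OF W _ _ part])
      show "set_borel_measurable lborel {0..t} f"
        unfolding set_borel_measurable_def
        using borel_measurable_continuous_on_indicator[OF _ fct] by simp
      show "I t \<in> borel_measurable M"
      proof (rule borel_measurable_LIMSEQ_real)
        show "(\<lambda>k. if \<omega> \<in> N then 0 else S k \<omega>) \<longlonglongrightarrow> I t \<omega>" if "\<omega> \<in> space M" for \<omega>
          using lim[of \<omega>] that by (cases "\<omega> \<in> N") (auto simp: I_def)
        show "(\<lambda>\<omega>. if \<omega> \<in> N then 0 else S k \<omega>) \<in> borel_measurable M" for k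
          by measurable
      qed
      show "AE \<omega> in M. (\<lambda>k. step_integral B (Suc k) (\<lambda>i. t * real i / real (Suc k))
          (\<lambda>i. f (t * real i / real (Suc k))) \<omega>) \<longlonglongrightarrow> I t \<omega>"
        using aeN by eventually_elim (use lim in \<open>auto simp: S_def\<close>)
    qed (use step_function_uniform_L2[OF _ fct] t in auto)
  qed
  have "AE \<omega> in M. continuous_on {0..<T} (\<lambda>t. I t \<omega>)"
    using aeN
  proof eventually_elim
    case (elim \<omega>)
    have b: "continuous_on {0..<T} (\<lambda>t. B t \<omega>)"
      using good[OF elim] by (auto intro: continuous_on_subset)
    have "continuous_on {0..<T} (\<lambda>t. integral {0..t} (\<lambda>s. B s \<omega> * f' s))"
      unfolding continuous_on_eq_continuous_within
      by (intro ballI DERIV_continuous[OF integral_has_derivative_atLeastLessThan] continuous_on_mult b f'c)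
    then show ?case
      using elim b fc by (auto simp: I_def J_def intro!: continuous_intros)
  qed
  then have "is_continuous_wiener_integral M B T f I"
    using int by (simp add: is_continuous_wiener_integral_def)
  moreover have "AE \<omega> in M. \<forall>t\<in>{0..<T}. I t \<omega> = J t \<omega>"
    using aeN by eventually_elim (simp add: I_def)
  ultimately show ?thesis using that[of I] by (simp add: J_def)
qed

text \<open>Uniqueness holds almost surely at each time. The rational times need only countably many
  null sets, and continuity extends the equality to all times.\<close>

lemma continuous_wiener_integral_indistinguishable:
  assumes W: "standard_wiener_process M B"
    and I: "is_continuous_wiener_integral M B T f I" and I': "is_continuous_wiener_integral M B T f I'"
  shows "AE \<omega> in M. \<forall>t\<in>{0..<T}. I t \<omega> = I' t \<omega>"
proof -
  have "AE \<omega> in M. \<forall>t\<in>{0..<T} \<inter> \<rat>. I t \<omega> = I' t \<omega>"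
    using I I' by (intro AE_ball_countable' has_wiener_integral_unique[OF W])
      (auto simp: is_continuous_wiener_integral_def intro: countable_Int2 countable_rat)
  moreover have "AE \<omega> in M. continuous_on {0..<T} (\<lambda>t. I t \<omega>)"
    "AE \<omega> in M. continuous_on {0..<T} (\<lambda>t. I' t \<omega>)"
    using I I' by (auto simp: is_continuous_wiener_integral_def)
  ultimately show ?thesis
  proof eventually_elim
    case (elim \<omega>)
    show ?case
    proof
      fix t assume t: "t \<in> {0..<T}"
      \<comment> \<open>Approximation from the right also reaches \<open>t = 0\<close>, and the
        bound by \<open>T\<close> keeps \<open>q k\<close> in \<open>[0,T)\<close>.\<close>
      have "\<forall>k. \<exists>q\<in>\<rat>. t < q \<and> q < min T (t + 1 / real (Suc k))"
        using t by (intro allI Rats_dense_in_real) simp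
      then obtain q where q: "\<And>k. q k \<in> \<rat>" "\<And>k. t < q k" "\<And>k. q k < min T (t + 1 / real (Suc k))"
        by metis
      have "(\<lambda>k. 1 / real (Suc k)) \<longlonglongrightarrow> 0"
        using LIMSEQ_Suc[OF lim_const_over_n[of 1]] by simp
      then have "(\<lambda>k. q k - t) \<longlonglongrightarrow> 0"
        by (rule Lim_null_comparison[rotated]) (use q in \<open>auto intro!: always_eventually simp: less_imp_le diff_le_eq add.commute\<close>)
      then have qt: "q \<longlonglongrightarrow> t" by (simp add: LIM_zero_iff)
      have qT: "q k \<in> {0..<T}" for k using q(2,3)[of k] t by auto
      have "(\<lambda>k. I (q k) \<omega>) \<longlonglongrightarrow> I t \<omega>" "(\<lambda>k. I' (q k) \<omega>) \<longlonglongrightarrow> I' t \<omega>"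
        using continuous_on_tendsto_compose[OF elim(2) qt t] continuous_on_tendsto_compose[OF elim(3) qt t] qT
        by auto
      moreover have "I (q k) \<omega> = I' (q k) \<omega>" for k using elim(1) q(1) qT by auto
      ultimately show "I t \<omega> = I' t \<omega>" using LIMSEQ_unique by simp
    qed
  qed
qed

text \<open>Near \<open>T\<close> the function \<open>\<alpha>\<close> exceeds some
  \<open>m > 0\<close>, so \<open>A t + m * ln (T - t)\<close> is nondecreasing there. Hence
  \<open>A t\<close> dominates a constant minus \<open>m * ln (T - t)\<close>, which tends to
  infinity.\<close>

lemma bridge_exponent_at_top:
  fixes \<alpha> :: "real \<Rightarrow> real"
  assumes T: "0 < T" and \<alpha>: "continuous_on {0..<T} \<alpha>"
    and lim: "(\<alpha> \<longlongrightarrow> \<alpha>T) (at_left T)" and pos: "\<alpha>T > 0"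
  shows "filterlim (\<lambda>t. integral {0..t} (\<lambda>u. \<alpha> u / (T - u))) at_top (at_left T)"
proof -
  define m where "m = \<alpha>T / 2"
  have m: "0 < m" "m < \<alpha>T" using pos by (auto simp: m_def)
  obtain t0 where t0: "t0 < T" "\<And>s. t0 < s \<Longrightarrow> s < T \<Longrightarrow> m < \<alpha> s"
    using order_tendstoD(1)[OF lim m(2)] T unfolding eventually_at_left[OF T] by blast
  \<comment> \<open>Beyond \<open>t0\<close>, for the lower bound on \<open>\<alpha>\<close>, and
    positive, for two-sided derivatives of \<open>A\<close>.\<close>
  define t1 where "t1 = (max 0 t0 + T) / 2"
  have t1: "0 < t1" "t0 < t1" "t1 < T" using T t0(1) by (auto simp: t1_def)
  define A where "A t = integral {0..t} (\<lambda>u. \<alpha> u / (T - u))" for t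
  have A: "(A has_real_derivative \<alpha> s / (T - s)) (at s)" if "0 < s" "s < T" for s
  proof -
    have "(A has_real_derivative \<alpha> s / (T - s)) (at s within {0..<T})"
      unfolding A_def by (rule integral_has_derivative_atLeastLessThan)
        (use that \<alpha> in \<open>auto intro!: continuous_intros\<close>)
    then show ?thesis using that by (subst (asm) at_within_interior) auto
  qed
  have "A t1 + m * ln (T - t1) - m * ln (T - t) \<le> A t" if t: "t1 \<le> t" "t < T" for t
  proof -
    have "A t1 + m * ln (T - t1) \<le> A t + m * ln (T - t)"
    proof (rule DERIV_nonneg_imp_nondecreasing[OF t(1)])
      fix s assume s: "t1 \<le> s" "s \<le> t"
      have "((\<lambda>t. A t + m * ln (T - t)) has_real_derivative \<alpha> s / (T - s) - m / (T - s)) (at s)"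
        using s t t1 by (auto intro!: derivative_eq_intros A)
      moreover have "0 \<le> \<alpha> s / (T - s) - m / (T - s)"
        using t0(2)[of s] s t t1 by (simp add: divide_right_mono)
      ultimately show "\<exists>y. ((\<lambda>t. A t + m * ln (T - t)) has_real_derivative y) (at s) \<and> 0 \<le> y" by blast
    qed
    then show ?thesis by simp
  qed
  moreover have "eventually (\<lambda>t. t \<in> {t1<..<T}) (at_left T)"
    by (rule eventually_at_left_real[OF t1(3)])
  ultimately have ev: "eventually (\<lambda>t. A t1 + m * ln (T - t1) - m * ln (T - t) \<le> A t) (at_left T)"
    by (auto elim!: eventually_mono)
  have "filterlim (\<lambda>t. c - m * ln (T - t)) at_top (at_left T)" for c
    using m(1) by real_asymp
  from filterlim_at_top_mono[OF this ev] show ?thesis by (simp add: A_def)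
qed

theorem theorem3p3:
  fixes M :: "'a measure"
    and F :: "real \<Rightarrow> 'a measure"
    and B :: "real \<Rightarrow> 'a \<Rightarrow> real"
    and \<alpha> :: "real \<Rightarrow> real"
    and T \<alpha>T :: real
  assumes "0 < T"
    and "continuous_on {0..<T} \<alpha>"
    and "filtered_prob_space M T F"
    and "usual_conditions M T F"
    and "standard_wiener_process M B"
    and "\<forall>t\<in>{0..<T}. sets (F t) = augmented_natural_sets M B t"
    and "(\<alpha> \<longlongrightarrow> \<alpha>T) (at_left T)"
    and "\<alpha>T > 0"
  shows "gauss_process M {0..T} (alpha_wiener_bridge M B T \<alpha>)
    \<and> centered_process M {0..T} (alpha_wiener_bridge M B T \<alpha>)
    \<and> (AE \<omega> in M. continuous_on {0..T} (\<lambda>t. alpha_wiener_bridge M B T \<alpha> t \<omega>))"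
proof -
  note T = assms(1) and W = assms(5)
  define g where "g u = \<alpha> u / (T - u)" for u
  define A where "A t = integral {0..t} g" for t
  define f where "f t = exp (A t)" for t
  define f' where "f' t = f t * g t" for t
  define I where "I = wiener_integral M B T f"
  define X where "X = alpha_wiener_bridge M B T \<alpha>"
  have X: "X t \<omega> = (if t < T then exp (- A t) * I t \<omega> else 0)" for t \<omega>
    by (simp add: X_def alpha_wiener_bridge_def A_def I_def f_def[abs_def] g_def[abs_def])
  have gc: "continuous_on {0..<T} g"
    unfolding g_def using assms(2) by (auto intro!: continuous_intros)
  have A: "(A has_real_derivative g s) (at s within {0..<T})" if "s \<in> {0..<T}" for s
    unfolding A_def by (rule integral_has_derivative_atLeastLessThan[OF gc that])
  have Ac: "continuous_on {0..<T} A"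
    unfolding continuous_on_eq_continuous_within by (intro ballI DERIV_continuous[OF A])
  have f: "(f has_real_derivative f' s) (at s within {0..<T})" if "s \<in> {0..<T}" for s
    unfolding f_def f'_def by (auto intro!: derivative_eq_intros A that)
  have f'c: "continuous_on {0..<T} f'"
    unfolding f'_def f_def by (intro continuous_intros Ac gc)
  obtain Y where Y: "is_continuous_wiener_integral M B T f Y"
    "AE \<omega> in M. \<forall>t\<in>{0..<T}. Y t \<omega> = f t * B t \<omega> - integral {0..t} (\<lambda>s. B s \<omega> * f' s)"
    using continuous_wiener_integral_by_parts[OF W f'c f] by blast
  \<comment> \<open>The explicit process \<open>Y\<close> shows that a continuous version exists, so
    the representative picked by \<open>SOME\<close> is one.\<close>
  have I: "is_continuous_wiener_integral M B T f I"
    unfolding I_def wiener_integral_def by (rule someI[of _ Y]) (rule Y(1))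
  \<comment> \<open>Below \<open>T\<close> the value is a multiple of a Wiener integral; at
    \<open>T\<close> it is the zero combination, a degenerate Gaussian.\<close>
  have limit: "wiener_limit M B (X t)" if t: "t \<in> {0..T}" for t
  proof (cases "t < T")
    case True
    then have "wiener_limit M B (I t)"
      using I t by (auto simp: is_continuous_wiener_integral_def intro: has_wiener_integral_imp_wiener_limit)
    from wiener_limit_linear[OF W this wiener_limit_zero, of "exp (- A t)"]
    show ?thesis using True by (simp add: X[abs_def])
  next
    case False
    then show ?thesis using wiener_limit_zero by (simp add: X[abs_def])
  qed
  have top: "filterlim f at_top (at_left T)"
    unfolding f_def A_def g_def
    by (rule filterlim_compose[OF exp_at_top bridge_exponent_at_top[OF T assms(2,7,8)]])
  \<comment> \<open>The positive limit gives \<open>\<alpha> s > 0\<close>, hence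
    \<open>f' s > 0\<close>, near \<open>T\<close>.\<close>
  have f'0: "eventually (\<lambda>s. f' s \<noteq> 0) (at_left T)"
    using order_tendstoD(1)[OF assms(7,8)] eventually_at_left_real[OF T]
    by eventually_elim (auto simp: f'_def f_def g_def)
  have "AE \<omega> in M. continuous_on {0..} (\<lambda>t. B t \<omega>)"
    using W by (simp add: standard_wiener_process_def)
  moreover have "AE \<omega> in M. continuous_on {0..<T} (\<lambda>t. I t \<omega>)"
    using I by (simp add: is_continuous_wiener_integral_def)
  ultimately have "AE \<omega> in M. continuous_on {0..T} (\<lambda>t. X t \<omega>)"
    using Y(2) continuous_wiener_integral_indistinguishable[OF W I Y(1)]
  proof eventually_elim
    case (elim \<omega>)
    have b: "continuous_on {0..T} (\<lambda>t. B t \<omega>)" by (rule continuous_on_subset[OF elim(1)]) auto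
    have "((\<lambda>t. integral {0..t} (\<lambda>s. B s \<omega> * f' s) / f t) \<longlongrightarrow> B T \<omega>) (at_left T)"
    proof (rule weighted_average_tendsto[OF T b f'c _ top f'0])
      show "(f has_real_derivative f' s) (at s)" if "s \<in> {0<..<T}" for s
        using f[of s] that at_within_interior[of s "{0..<T}"] by simp
    qed
    moreover have "((\<lambda>t. B t \<omega>) \<longlongrightarrow> B T \<omega>) (at_left T)"
      using b T by (auto simp: continuous_on_def at_within_Icc_at_left dest!: bspec[of _ _ T])
    ultimately have "((\<lambda>t. B t \<omega> - integral {0..t} (\<lambda>s. B s \<omega> * f' s) / f t) \<longlongrightarrow> B T \<omega> - B T \<omega>) (at_left T)"
      by (intro tendsto_diff)
    \<comment> \<open>Outside one null set the chosen version agrees with \<open>Y\<close> at all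
      times at once, and \<open>exp (- A t)\<close> cancels the factor \<open>f t\<close> of
      \<open>B t \<omega>\<close>.\<close>
    moreover have "eventually (\<lambda>t. B t \<omega> - integral {0..t} (\<lambda>s. B s \<omega> * f' s) / f t = X t \<omega>) (at_left T)"
      using eventually_at_left_real[OF T]
    proof eventually_elim
      case (elim t)
      then have "t \<in> {0..<T}" by auto
      then show ?case
        using \<open>\<forall>t\<in>{0..<T}. I t \<omega> = Y t \<omega>\<close> \<open>\<forall>t\<in>{0..<T}. Y t \<omega> = _\<close>
        by (simp add: X f_def exp_minus field_simps)
    qed
    ultimately have XT: "((\<lambda>t. X t \<omega>) \<longlongrightarrow> X T \<omega>) (at_left T)"
      using Lim_transform_eventually[of _ "B T \<omega> - B T \<omega>"] by (simp add: X)
    have Xc: "continuous_on {0..<T} (\<lambda>t. X t \<omega>)"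
      using elim(2) Ac by (subst continuous_on_cong[OF refl, where g="\<lambda>t. exp (- A t) * I t \<omega>"])
        (auto simp: X intro!: continuous_intros)
    show ?case
      unfolding continuous_on_def
    proof
      fix t assume t: "t \<in> {0..T}"
      show "((\<lambda>t. X t \<omega>) \<longlongrightarrow> X t \<omega>) (at t within {0..T})"
      proof (cases "t < T")
        case True
        then have "at t within {0..T} = at t within {0..<T}"
          by (intro at_within_nhd[of _ "{..<T}"]) auto
        then show ?thesis using Xc t True by (simp add: continuous_on_def)
      next
        case False
        then show ?thesis using t T XT by (simp add: at_within_Icc_at_left)
      qed
    qed
  qed
  moreover have "gauss_process M {0..T} X"
    unfolding gauss_process_def
  proof (intro conjI ballI allI impI)
    show "X t \<in> borel_measurable M" if "t \<in> {0..T}" for t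
      using limit[OF that] by (simp add: wiener_limit_def)
    show "gaussian_rv M (\<lambda>\<omega>. \<Sum>t\<in>J. c t * X t \<omega>)" if "finite J \<and> J \<subseteq> {0..T}" for J c
      using that by (intro wiener_limit_gaussian[OF W] wiener_limit_sum[OF W] limit) auto
  qed
  moreover have "centered_process M {0..T} X"
    unfolding centered_process_def using wiener_limit_gaussian[OF W limit] by blast
  ultimately show ?thesis by (simp add: X_def)
qed

end
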